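(* The category of strongly exact Frith frames is (embedded via the functor $\mathbf{Sk}_{\rm Frith}$) a full coreflective subcategory of the category of zero-dimensional biframes. That is, $\mathbf{Sk}_{\rm Frith}$ restricts to a fully faithful functor from strongly exact Frith frames to zero-dimensional biframes, and this functor has a right adjoint.
   Context: A Frith frame is a pair $(L,S)$ where $L$ is a frame and $S$ is a bounded sublattice of $L$ that is join-dense (every element of $L$ is a join of elements of $S$). A morphism $(L,S)\to(M,T)$ is a frame homomorphism $h:L\to M$ with $h[S]\subseteq T$. For a frame $L$, $\mathcal C L$ is the frame of frame congruences on $L$ ordered by inclusion. For $a\in L$, $\nabla_a=\{(x,y)\mid a\vee x=a\vee y\}$ and $\Delta_a=\{(x,y)\mid a\wedge x=a\wedge y\}$; these are complements of each other in $\mathcal CL$. For $S\subseteq L$, $\nabla S$ and $\Delta S$ are the subframes of $\mathcal CL$ generated by $\{\nabla_s\mid s\in S\}$ and $\{\Delta_s\mid s\in S\}$, and $\mathcal C_SL$ is the subframe of $\mathcal CL$ generated by $\nabla L\cup\Delta S$. The map $\nabla:L\to\mathcal C_SL$, $a\mapsto\nabla_a$, is a frame embedding, and it is universal among frame homomorphisms $h:L\to M$ such that $h(s)$ is complemented for all $s\in S$: each such $h$ extends uniquely along $\nabla$ to a frame homomorphism $\mathcal C_SL\to M$. For $P\subseteq L$, the meet $\bigwedge P$ is strongly exact if the congruence $\bigvee_{s\in P}\Delta_s$ (join in $\mathcal CL$) equals $\Delta_a$ for some $a\in L$ (then necessarily $a=\bigwedge P$). The Frith frame $(L,S)$ is strongly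 exact if $\bigwedge P\in S$ for every $P\subseteq S$ such that the meet $\bigwedge P$ is strongly exact. Strongly exact Frith frames are regarded as a full subcategory of Frith frames. A biframe is a triple $(L,L_+,L_-)$ where $L_+,L_-$ are subframes of the frame $L$ and every element of $L$ is a join of finite meets of elements of $L_+\cup L_-$; a morphism $(L,L_+,L_-)\to(M,M_+,M_-)$ is a frame homomorphism $h:L\to M$ with $h[L_+]\subseteq M_+$ and $h[L_-]\subseteq M_-$. An element of $L_+$ (resp. $L_-$) is bicomplemented if it is complemented in $L$ with complement in $L_-$ (resp. $L_+$). The biframe is zero-dimensional if $L_+$ and $L_-$ are both join-generated by their bicomplemented elements. Zero-dimensional biframes are regarded as a full subcategory of biframes. The functor $\mathbf{Sk}_{\rm Frith}$ from Frith frames to biframes sends $(L,S)$ to $(\mathcal C_SL,\nabla L,\Delta S)$ and a morphism $h:(L,S)\to(M,T)$ to the unique frame homomorphism $\overline h:\mathcal C_SL\to\mathcal C_TM$ with $\overline h(\nabla_a)=\nabla_{h(a)}$ for all $a\in L$. *)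

theory Defs
  imports "HOL-Algebra.Complete_Lattice" "HOL-Library.FuncSet"
begin

section \<open>Frames\<close>

locale frame = complete_lattice L for L (structure) +
  assumes meet_Sup_distrib:
    "\<lbrakk>x \<in> carrier L; A \<subseteq> carrier L\<rbrakk> \<Longrightarrow> x \<sqinter> \<Squnion>A = \<Squnion>((\<lambda>a. x \<sqinter> a) ` A)"

definition subframe :: "('a, 'm) gorder_scheme \<Rightarrow> 'a set \<Rightarrow> bool" where
  "subframe L K \<longleftrightarrow>
     K \<subseteq> carrier L \<and> \<top>\<^bsub>L\<^esub> \<in> K \<and>
     (\<forall>x\<in>K. \<forall>y\<in>K. x \<sqinter>\<^bsub>L\<^esub> y \<in> K) \<and>
     (\<forall>A. A \<subseteq> K \<longrightarrow> \<Squnion>\<^bsub>L\<^esub>A \<in> K)"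

definition subframe_generated :: "('a, 'm) gorder_scheme \<Rightarrow> 'a set \<Rightarrow> 'a set" where
  "subframe_generated L X = \<Inter>{K. subframe L K \<and> X \<subseteq> K}"

definition join_generates :: "('a, 'm) gorder_scheme \<Rightarrow> 'a set \<Rightarrow> 'a set \<Rightarrow> bool" where
  "join_generates L S K \<longleftrightarrow> (\<forall>x\<in>K. \<exists>A. A \<subseteq> S \<and> x = \<Squnion>\<^bsub>L\<^esub>A)"

definition complements :: "('a, 'm) gorder_scheme \<Rightarrow> 'a \<Rightarrow> 'a \<Rightarrow> bool" where
  "complements L a b \<longleftrightarrow>
     a \<in> carrier L \<and> b \<in> carrier L \<and> a \<sqinter>\<^bsub>L\<^esub> b = \<bottom>\<^bsub>L\<^esub> \<and> a \<squnion>\<^bsub>L\<^esub> b = \<top>\<^bsub>L\<^esub>"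

text \<open>
  Morphisms are extensional functions (\<^const>\<open>undefined\<close> outside the carrier), so that
  equality of morphisms is equality of HOL functions; identities and composites are
  \<^term>\<open>\<lambda>x\<in>carrier L. x\<close> and \<^const>\<open>compose\<close>.
  Preservation of the bottom element is the case \<^term>\<open>A = {}\<close>.
\<close>

definition frame_hom ::
  "('a, 'm) gorder_scheme \<Rightarrow> ('b, 'n) gorder_scheme \<Rightarrow> ('a \<Rightarrow> 'b) set" where
  "frame_hom L M =
     {h \<in> carrier L \<rightarrow>\<^sub>E carrier M.
        h \<top>\<^bsub>L\<^esub> = \<top>\<^bsub>M\<^esub> \<and>
        (\<forall>x\<in>carrier L. \<forall>y\<in>carrier L. h (x \<sqinter>\<^bsub>L\<^esub> y) = h x \<sqinter>\<^bsub>M\<^esub> h y) \<and>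
        (\<forall>A. A \<subseteq> carrier L \<longrightarrow> h (\<Squnion>\<^bsub>L\<^esub>A) = \<Squnion>\<^bsub>M\<^esub>(h ` A))}"


section \<open>Frame congruences\<close>

text \<open>
  A frame congruence is an equivalence relation on \<^term>\<open>L\<close> that is a subframe of \<^term>\<open>L \<times> L\<close>.
  In the last clause, \<^term>\<open>R\<close> is an arbitrary family of related pairs.
\<close>

definition frame_congruence :: "('a, 'm) gorder_scheme \<Rightarrow> ('a \<times> 'a) set \<Rightarrow> bool" where
  "frame_congruence L \<theta> \<longleftrightarrow>
     equiv (carrier L) \<theta> \<and>
     (\<forall>x y x' y'. (x, y) \<in> \<theta> \<longrightarrow> (x', y') \<in> \<theta> \<longrightarrow> (x \<sqinter>\<^bsub>L\<^esub> x', y \<sqinter>\<^bsub>L\<^esub> y') \<in> \<theta>) \<and>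
     (\<forall>R. R \<subseteq> \<theta> \<longrightarrow> (\<Squnion>\<^bsub>L\<^esub>(fst ` R), \<Squnion>\<^bsub>L\<^esub>(snd ` R)) \<in> \<theta>)"

definition congruence_frame :: "('a, 'm) gorder_scheme \<Rightarrow> ('a \<times> 'a) set gorder" where
  "congruence_frame L = \<lparr>carrier = {\<theta>. frame_congruence L \<theta>}, eq = (=), le = (\<subseteq>)\<rparr>"

definition nabla :: "('a, 'm) gorder_scheme \<Rightarrow> 'a \<Rightarrow> ('a \<times> 'a) set" where
  "nabla L a = {(x, y). x \<in> carrier L \<and> y \<in> carrier L \<and> a \<squnion>\<^bsub>L\<^esub> x = a \<squnion>\<^bsub>L\<^esub> y}"

definition delta :: "('a, 'm) gorder_scheme \<Rightarrow> 'a \<Rightarrow> ('a \<times> 'a) set" where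
  "delta L a = {(x, y). x \<in> carrier L \<and> y \<in> carrier L \<and> a \<sqinter>\<^bsub>L\<^esub> x = a \<sqinter>\<^bsub>L\<^esub> y}"

definition nabla_frame :: "('a, 'm) gorder_scheme \<Rightarrow> 'a set \<Rightarrow> ('a \<times> 'a) set set" where
  "nabla_frame L S = subframe_generated (congruence_frame L) (nabla L ` S)"

definition delta_frame :: "('a, 'm) gorder_scheme \<Rightarrow> 'a set \<Rightarrow> ('a \<times> 'a) set set" where
  "delta_frame L S = subframe_generated (congruence_frame L) (delta L ` S)"

definition congruences_over :: "('a, 'm) gorder_scheme \<Rightarrow> 'a set \<Rightarrow> ('a \<times> 'a) set set" where
  "congruences_over L S =
     subframe_generated (congruence_frame L) (nabla_frame L (carrier L) \<union> delta_frame L S)"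


section \<open>Frith frames\<close>

record 'a frith = "'a gorder" +
  gens :: "'a set"

locale frith_frame = frame F for F :: "'a frith" (structure) +
  assumes gens_subset: "gens F \<subseteq> carrier F"
    and top_gens: "\<top> \<in> gens F"
    and bottom_gens: "\<bottom> \<in> gens F"
    and meet_gens: "\<lbrakk>s \<in> gens F; t \<in> gens F\<rbrakk> \<Longrightarrow> s \<sqinter> t \<in> gens F"
    and join_gens: "\<lbrakk>s \<in> gens F; t \<in> gens F\<rbrakk> \<Longrightarrow> s \<squnion> t \<in> gens F"
    and gens_join_dense: "join_generates F (gens F) (carrier F)"

definition strongly_exact_meet :: "('a, 'm) gorder_scheme \<Rightarrow> 'a set \<Rightarrow> bool" where
  "strongly_exact_meet L P \<longleftrightarrow>
     (\<exists>a\<in>carrier L. \<Squnion>\<^bsub>congruence_frame L\<^esub>(delta L ` P) = delta L a)"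

locale strongly_exact_frith_frame = frith_frame F for F :: "'a frith" (structure) +
  assumes strongly_exact: "\<lbrakk>P \<subseteq> gens F; strongly_exact_meet F P\<rbrakk> \<Longrightarrow> \<Sqinter>P \<in> gens F"

definition frith_hom :: "'a frith \<Rightarrow> 'b frith \<Rightarrow> ('a \<Rightarrow> 'b) set" where
  "frith_hom F G = {h \<in> frame_hom F G. h ` gens F \<subseteq> gens G}"


section \<open>Biframes\<close>

record 'a biframe_rec = "'a gorder" +
  pos :: "'a set"
  neg :: "'a set"

locale biframe = frame B for B :: "'a biframe_rec" (structure) +
  assumes subframe_pos: "subframe B (pos B)"
    and subframe_neg: "subframe B (neg B)"
    and pos_neg_generate:
      "join_generates B {\<Sqinter>X | X. finite X \<and> X \<subseteq> pos B \<union> neg B} (carrier B)"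

definition bicomplemented_pos :: "'a biframe_rec \<Rightarrow> 'a set" where
  "bicomplemented_pos B = {a \<in> pos B. \<exists>b\<in>neg B. complements B a b}"

definition bicomplemented_neg :: "'a biframe_rec \<Rightarrow> 'a set" where
  "bicomplemented_neg B = {a \<in> neg B. \<exists>b\<in>pos B. complements B a b}"

locale zero_dimensional_biframe = biframe B for B :: "'a biframe_rec" (structure) +
  assumes zero_dimensional_pos: "join_generates B (bicomplemented_pos B) (pos B)"
    and zero_dimensional_neg: "join_generates B (bicomplemented_neg B) (neg B)"

definition biframe_hom :: "'a biframe_rec \<Rightarrow> 'b biframe_rec \<Rightarrow> ('a \<Rightarrow> 'b) set" where
  "biframe_hom A B = {h \<in> frame_hom A B. h ` pos A \<subseteq> pos B \<and> h ` neg A \<subseteq> neg B}"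


section \<open>The functor from Frith frames to biframes\<close>

definition Sk :: "'a frith \<Rightarrow> ('a \<times> 'a) set biframe_rec" where
  "Sk F = \<lparr>carrier = congruences_over F (gens F), eq = (=), le = (\<subseteq>),
           pos = nabla_frame F (carrier F), neg = delta_frame F (gens F)\<rparr>"

definition extends_along_nabla ::
  "'a frith \<Rightarrow> 'b frith \<Rightarrow> ('a \<Rightarrow> 'b) \<Rightarrow> (('a \<times> 'a) set \<Rightarrow> ('b \<times> 'b) set) \<Rightarrow> bool" where
  "extends_along_nabla F G h g \<longleftrightarrow>
     g \<in> frame_hom (Sk F) (Sk G) \<and> (\<forall>a\<in>carrier F. g (nabla F a) = nabla G (h a))"

definition Sk_map ::
  "'a frith \<Rightarrow> 'b frith \<Rightarrow> ('a \<Rightarrow> 'b) \<Rightarrow> ('a \<times> 'a) set \<Rightarrow> ('b \<times> 'b) set" where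
  "Sk_map F G h = (THE g. extends_along_nabla F G h g)"


section \<open>The right adjoint\<close>

text \<open>
  The right adjoint sends a zero-dimensional biframe \<^term>\<open>(B, pos B, neg B)\<close> to \<^term>\<open>pos B\<close> together
  with its bicomplemented elements.  Since \<^const>\<open>Sk\<close> changes the underlying type, the two categories
  range over all types, and HOL cannot quantify over types below an existential quantifier.
  Naming the functor and the hom-set bijection once, as polymorphic constants, makes the same
  choice serve Frith frames and biframes over arbitrary types.
\<close>

definition coreflector :: "'a biframe_rec \<Rightarrow> 'a frith" where
  "coreflector B = \<lparr>carrier = pos B, eq = (=), le = le B, gens = bicomplemented_pos B\<rparr>"

definition coreflector_map :: "'a biframe_rec \<Rightarrow> ('a \<Rightarrow> 'b) \<Rightarrow> 'a \<Rightarrow> 'b" where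
  "coreflector_map A f = restrict f (pos A)"

definition Sk_transpose :: "'a frith \<Rightarrow> (('a \<times> 'a) set \<Rightarrow> 'b) \<Rightarrow> 'a \<Rightarrow> 'b" where
  "Sk_transpose F g = (\<lambda>a\<in>carrier F. g (nabla F a))"

end

theory Submission
  imports Defs
begin

text \<open>
  Write \<open>S\<close> for \<^term>\<open>gens F\<close>.  The congruences \<^term>\<open>nabla F a \<inter> delta F s\<close> with
  \<open>s\<close> in \<open>S\<close> are closed under finite meets, because \<open>S\<close> is closed under finite joins.
  The congruences form a frame, so the elements of \<^term>\<open>Sk F\<close> are exactly the joins of these
  basic congruences.  This makes \<^term>\<open>Sk F\<close> a zero-dimensional biframe, and it shows that a
  frame homomorphism out of \<^term>\<open>Sk F\<close> is determined by its values on the \<^term>\<open>nabla F a\<close>: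
  these fix the values on the complements \<^term>\<open>delta F s\<close>, hence on basic congruences,
  hence on all joins.

  Conversely, let \<open>h\<close> be a frame homomorphism from \<^term>\<open>F\<close> to \<open>M\<close> which sends every \<open>s\<close> in \<open>S\<close>
  to an element with a complement \<open>c\<close>.  A basic congruence has to go to \<open>h a \<sqinter> c\<close>, and a
  congruence \<open>\<theta>\<close> to the join of the images of the basic congruences below it.  The resulting map
  sends \<open>\<theta>\<close> to an element below \<open>m\<close> iff \<open>\<theta>\<close> is contained in the kernel of \<open>x \<mapsto> m \<squnion> h x\<close>.
  For basic congruences this holds because \<^term>\<open>nabla F a \<inter> delta F s\<close> is generated by
  the pair of \<open>s\<close> and \<open>a \<squnion> s\<close>.  So the map has a right adjoint and preserves joins; binary meets
  follow from distributivity in \<open>M\<close>.  This is the universal property of the Skula biframe.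

  For a zero-dimensional biframe \<open>A\<close> the inclusion of \<^term>\<open>pos A\<close> into \<open>A\<close> sends
  bicomplemented elements to complemented ones, so the universal property gives the bijection
  \<^const>\<open>Sk_transpose\<close>.  Applied to the inclusion itself it yields the counit, and the counit shows
  that the coreflector is strongly exact: if a join of congruences \<^term>\<open>delta F s\<close> is
  \<^term>\<open>delta F a\<close>, then \<^term>\<open>delta F a\<close> lies in the negative part and is the complement of
  \<^term>\<open>nabla F a\<close>, and the counit carries this to the statement that \<open>a\<close> is bicomplemented.

  Finally, \<^const>\<open>Sk\<close> is faithful because \<open>\<nabla>\<close> is injective, and full because of strong exactness.
  The positive part of \<^term>\<open>Sk F\<close> is a copy of \<^term>\<open>F\<close>, and \<^term>\<open>nabla F a\<close> is bicomplemented
  iff \<^term>\<open>delta F a\<close> is a join of congruences \<^term>\<open>delta F s\<close>, that is, iff \<open>a\<close> is a strongly exact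
  meet of elements of \<open>S\<close>; strong exactness says that such an \<open>a\<close> is in \<open>S\<close>.  Hence a biframe
  homomorphism, restricted to positive parts, is a morphism of Frith frames.
\<close>

section \<open>Order and lattice identities in a frame\<close>

lemma (in complete_lattice) sup_eqI:
  assumes "A \<subseteq> carrier L" "s \<in> carrier L" "\<And>a. a \<in> A \<Longrightarrow> a \<sqsubseteq> s"
    and "\<And>u. u \<in> carrier L \<Longrightarrow> (\<And>a. a \<in> A \<Longrightarrow> a \<sqsubseteq> u) \<Longrightarrow> s \<sqsubseteq> u"
  shows "\<Squnion>A = s"
proof (rule le_antisym)
  show "\<Squnion>A \<sqsubseteq> s" "s \<sqsubseteq> \<Squnion>A"
    using assms sup_least[of A s] sup_upper[of A] sup_closed[of A] by blast+
qed (use assms in auto)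

lemma (in complete_lattice) inf_eqI:
  assumes "A \<subseteq> carrier L" "s \<in> carrier L" "\<And>a. a \<in> A \<Longrightarrow> s \<sqsubseteq> a"
    and "\<And>u. u \<in> carrier L \<Longrightarrow> (\<And>a. a \<in> A \<Longrightarrow> u \<sqsubseteq> a) \<Longrightarrow> u \<sqsubseteq> s"
  shows "\<Sqinter>A = s"
proof (rule le_antisym)
  show "\<Sqinter>A \<sqsubseteq> s" "s \<sqsubseteq> \<Sqinter>A"
    using assms inf_greatest[of A s] inf_lower[of A] inf_closed[of A] by blast+
qed (use assms in auto)

lemma (in partial_order) le_refl: "x \<in> carrier L \<Longrightarrow> x \<sqsubseteq> x"
  by (simp add: eq_is_equal)

lemma (in complete_lattice) Sup_le_iff:
  assumes "A \<subseteq> carrier L" "u \<in> carrier L"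
  shows "\<Squnion>A \<sqsubseteq> u \<longleftrightarrow> (\<forall>a\<in>A. a \<sqsubseteq> u)"
  using assms by (meson le_trans subsetD sup_closed sup_least sup_upper)

lemma (in complete_lattice) le_meet_iff:
  assumes "x \<in> carrier L" "y \<in> carrier L" "z \<in> carrier L"
  shows "z \<sqsubseteq> x \<sqinter> y \<longleftrightarrow> z \<sqsubseteq> x \<and> z \<sqsubseteq> y"
  using assms by (meson le_trans meet_closed meet_le meet_left meet_right)

lemma (in complete_lattice) join_le_iff:
  assumes "x \<in> carrier L" "y \<in> carrier L" "z \<in> carrier L"
  shows "x \<squnion> y \<sqsubseteq> z \<longleftrightarrow> x \<sqsubseteq> z \<and> y \<sqsubseteq> z"
  using assms by (meson le_trans join_closed join_le join_left join_right)

lemma (in complete_lattice) eqI_upper_bounds: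
  assumes "x \<in> carrier L" "y \<in> carrier L"
    and "\<And>u. u \<in> carrier L \<Longrightarrow> x \<sqsubseteq> u \<longleftrightarrow> y \<sqsubseteq> u"
  shows "x = y"
  using assms by (metis le_antisym refl eq_is_equal weak_refl)

lemma (in complete_lattice) le_iff_join_eq:
  assumes "x \<in> carrier L" "y \<in> carrier L"
  shows "x \<sqsubseteq> y \<longleftrightarrow> y \<squnion> x = y"
  using assms le_iff_meet[of x y] by (simp add: join_comm)

lemma (in complete_lattice) sup_empty_eq: "\<Squnion>{} = \<bottom>"
  using weak_sup_empty unfolding eq_is_equal .

context frame
begin

lemma Sup_meet_distrib:
  assumes "x \<in> carrier L" "A \<subseteq> carrier L"
  shows "\<Squnion>A \<sqinter> x = \<Squnion>((\<lambda>a. a \<sqinter> x) ` A)"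
  using meet_Sup_distrib[OF assms] by (simp add: meet_comm)

lemma meet_join_distrib:
  assumes "x \<in> carrier L" "y \<in> carrier L" "z \<in> carrier L"
  shows "x \<sqinter> (y \<squnion> z) = (x \<sqinter> y) \<squnion> (x \<sqinter> z)"
  using meet_Sup_distrib[of x "{y, z}"] assms by (simp add: join_def)

lemma join_meet_distrib:
  assumes "x \<in> carrier L" "y \<in> carrier L" "z \<in> carrier L"
  shows "x \<squnion> (y \<sqinter> z) = (x \<squnion> y) \<sqinter> (x \<squnion> z)"
proof -
  have "(x \<squnion> y) \<sqinter> (x \<squnion> z) = ((x \<squnion> y) \<sqinter> x) \<squnion> ((x \<squnion> y) \<sqinter> z)"
    using assms by (simp add: meet_join_distrib)
  also have "(x \<squnion> y) \<sqinter> x = x"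
    using assms by (metis join_closed join_left le_iff_join meet_comm)
  also have "x \<squnion> ((x \<squnion> y) \<sqinter> z) = x \<squnion> ((z \<sqinter> x) \<squnion> (z \<sqinter> y))"
    using assms by (simp add: meet_join_distrib meet_comm[of _ "x \<squnion> y" z])
  also have "\<dots> = (x \<squnion> (z \<sqinter> x)) \<squnion> (z \<sqinter> y)"
    using assms by (simp add: join_assoc)
  also have "x \<squnion> (z \<sqinter> x) = x"
    using assms by (metis le_iff_join_eq meet_closed meet_right)
  finally show ?thesis
    by (simp add: meet_comm)
qed

lemma join_Sup_distrib:
  assumes "x \<in> carrier L" "A \<subseteq> carrier L" "A \<noteq> {}"
  shows "x \<squnion> \<Squnion>A = \<Squnion>((\<lambda>a. x \<squnion> a) ` A)"
proof (rule eqI_upper_bounds)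
  have im: "(\<lambda>a. x \<squnion> a) ` A \<subseteq> carrier L" using assms by auto
  then show "\<Squnion>((\<lambda>a. x \<squnion> a) ` A) \<in> carrier L" by simp
  show "x \<squnion> \<Squnion>A \<in> carrier L" using assms by simp
  fix u assume "u \<in> carrier L"
  then show "(x \<squnion> \<Squnion>A \<sqsubseteq> u) = (\<Squnion>((\<lambda>a. x \<squnion> a) ` A) \<sqsubseteq> u)"
    using assms im by (auto simp: Sup_le_iff join_le_iff subset_iff)
qed

lemma Sup_meet_Sup_le:
  assumes "A \<subseteq> carrier L" "B \<subseteq> carrier L" "u \<in> carrier L"
    and "\<And>a b. a \<in> A \<Longrightarrow> b \<in> B \<Longrightarrow> a \<sqinter> b \<sqsubseteq> u"
  shows "\<Squnion>A \<sqinter> \<Squnion>B \<sqsubseteq> u"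
proof -
  have 1: "a \<sqinter> \<Squnion>B \<sqsubseteq> u" if "a \<in> A" for a
  proof -
    have "a \<in> carrier L" "\<And>b. b \<in> B \<Longrightarrow> b \<in> carrier L" using assms that by auto
    then have "a \<in> carrier L" "(\<lambda>b. a \<sqinter> b) ` B \<subseteq> carrier L" by auto
    then show ?thesis
      using assms that by (simp add: meet_Sup_distrib Sup_le_iff)
  qed
  have "(\<lambda>a. a \<sqinter> \<Squnion>B) ` A \<subseteq> carrier L" using assms by auto
  then show ?thesis
    using assms 1 by (auto simp: Sup_meet_distrib Sup_le_iff)
qed

text \<open>
  Meeting with the complement of \<^term>\<open>s\<close> is left adjoint to joining with \<^term>\<open>s\<close>.  Uniqueness
  of complements and the comparisons with values of the extension in the universal
  property are read off from this adjunction.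
\<close>

lemma meet_complement_le_iff:
  assumes "complements L s c" "x \<in> carrier L" "m \<in> carrier L"
  shows "x \<sqinter> c \<sqsubseteq> m \<longleftrightarrow> x \<sqsubseteq> s \<squnion> m"
proof -
  have sc: "s \<in> carrier L" "c \<in> carrier L" "s \<sqinter> c = \<bottom>" "s \<squnion> c = \<top>"
    using assms(1) by (auto simp: complements_def)
  show ?thesis
  proof
    assume le: "x \<sqinter> c \<sqsubseteq> m"
    have "x = x \<sqinter> (s \<squnion> c)"
      using assms(2) sc(4) le_iff_join[of x "\<top>"] by simp
    also have "\<dots> = (x \<sqinter> s) \<squnion> (x \<sqinter> c)"
      using meet_join_distrib[OF assms(2) sc(1,2)] .
    also have "\<dots> \<sqsubseteq> s \<squnion> m"
    proof -
      have "x \<sqinter> s \<sqsubseteq> s \<squnion> m"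
        using assms sc by (meson join_closed join_left le_trans meet_closed meet_right)
      moreover have "x \<sqinter> c \<sqsubseteq> s \<squnion> m"
        using assms sc le by (meson join_closed join_right le_trans meet_closed)
      ultimately show ?thesis
        using assms sc by (simp add: join_le_iff)
    qed
    finally show "x \<sqsubseteq> s \<squnion> m" .
  next
    assume le: "x \<sqsubseteq> s \<squnion> m"
    have "x \<sqinter> c \<sqsubseteq> c \<sqinter> (s \<squnion> m)"
      using assms sc le le_trans[OF meet_left le, of c] by (simp add: le_meet_iff meet_right)
    also have "c \<sqinter> (s \<squnion> m) = \<bottom> \<squnion> (c \<sqinter> m)"
      using assms sc by (simp add: meet_join_distrib meet_comm[of _ c s])
    also have "\<bottom> \<squnion> (c \<sqinter> m) = c \<sqinter> m"
      using assms sc bottom_join[of "c \<sqinter> m"] by (simp add: eq_is_equal)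
    also have "c \<sqinter> m \<sqsubseteq> m"
      using assms sc by (simp add: meet_right)
    finally show "x \<sqinter> c \<sqsubseteq> m"
      using assms sc by simp
  qed
qed

lemma complements_sym: "complements L a b \<Longrightarrow> complements L b a"
  by (simp add: complements_def meet_comm join_comm)

lemma complement_unique:
  assumes "complements L s c" "complements L s d"
  shows "c = d"
proof -
  have "c \<sqsubseteq> d" if "complements L s c" "complements L s d" for c d
  proof -
    have cd: "s \<in> carrier L" "c \<in> carrier L" "d \<in> carrier L" "s \<squnion> d = \<top>"
      using that by (auto simp: complements_def)
    then have "\<top> \<sqinter> c \<sqsubseteq> d"
      using meet_complement_le_iff[OF that(1), of "\<top>" d] by simp
    then show ?thesis using top_meet[of c] cd by (simp add: eq_is_equal)
  qed
  with assms show ?thesis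
    by (meson complements_def le_antisym)
qed

lemma complements_top_bottom: "complements L \<top> \<bottom>"
  using top_meet[of \<bottom>] bottom_join[of \<top>] by (simp add: complements_def join_comm eq_is_equal)

lemma complements_meet:
  assumes "complements L a a'" "complements L b b'"
  shows "complements L (a \<sqinter> b) (a' \<squnion> b')"
proof -
  have c: "a \<in> carrier L" "b \<in> carrier L" "a' \<in> carrier L" "b' \<in> carrier L"
    using assms by (auto simp: complements_def)
  have c2: "a \<sqinter> a' = \<bottom>" "b \<sqinter> b' = \<bottom>" "a \<squnion> a' = \<top>" "b \<squnion> b' = \<top>"
    using assms by (auto simp: complements_def)
  have "(a \<sqinter> b) \<sqinter> a' \<sqsubseteq> a \<sqinter> a'" "(a \<sqinter> b) \<sqinter> b' \<sqsubseteq> b \<sqinter> b'"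
    using c le_meet_iff[of a b "a \<sqinter> b"]
    by (simp_all add: le_meet_iff meet_left meet_right le_trans[OF meet_left, of "a \<sqinter> b"])
  then have "(a \<sqinter> b) \<sqinter> (a' \<squnion> b') \<sqsubseteq> \<bottom>"
    using c c2 by (simp add: meet_join_distrib join_le_iff)
  moreover have "a \<squnion> a' \<sqsubseteq> (a' \<squnion> b') \<squnion> a" "b \<squnion> b' \<sqsubseteq> (a' \<squnion> b') \<squnion> b"
    using c join_le_iff[of a' b' "a' \<squnion> b'"]
    by (simp_all add: join_le_iff join_left join_right le_trans[OF _ join_left, of _ "a' \<squnion> b'"])
  then have "\<top> \<sqsubseteq> (a \<sqinter> b) \<squnion> (a' \<squnion> b')"
    using c c2 by (simp add: join_comm[of _ "a \<sqinter> b"] join_meet_distrib le_meet_iff)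
  ultimately show ?thesis
    using c by (auto simp: complements_def intro!: le_antisym)
qed

lemma complements_join:
  assumes "complements L a a'" "complements L b b'"
  shows "complements L (a \<squnion> b) (a' \<sqinter> b')"
  using complements_meet[of a' a b' b] assms complements_sym by blast

end


section \<open>Subframes\<close>

context frame
begin

lemma subframe_bottom: "subframe L K \<Longrightarrow> \<bottom> \<in> K"
  by (metis subframe_def empty_subsetI sup_empty_eq)

lemma subframe_join:
  assumes "subframe L K" "x \<in> K" "y \<in> K"
  shows "x \<squnion> y \<in> K"
  using assms by (simp add: subframe_def join_def)

lemma subframe_carrier: "subframe L (carrier L)"
  by (simp add: subframe_def)

lemma subframe_subframe_generated:
  assumes "X \<subseteq> carrier L"
  shows "subframe L (subframe_generated L X)"
proof -
  have "subframe_generated L X \<subseteq> carrier L"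
    using assms subframe_carrier unfolding subframe_generated_def by blast
  then show ?thesis
    unfolding subframe_def subframe_generated_def by blast
qed

lemma subset_subframe_generated: "X \<subseteq> subframe_generated L X"
  unfolding subframe_generated_def by blast

lemma subframe_generated_least: "subframe L K \<Longrightarrow> X \<subseteq> K \<Longrightarrow> subframe_generated L X \<subseteq> K"
  unfolding subframe_generated_def by blast

lemma subframe_generated_closed: "X \<subseteq> carrier L \<Longrightarrow> subframe_generated L X \<subseteq> carrier L"
  using subframe_generated_least[OF subframe_carrier] .

lemma join_of_elements_below:
  assumes X: "X \<subseteq> carrier L" and y: "y \<in> carrier L"
    and dense: "\<And>u. u \<in> carrier L \<Longrightarrow> (\<And>x. x \<in> X \<Longrightarrow> x \<sqsubseteq> y \<Longrightarrow> x \<sqsubseteq> u) \<Longrightarrow> y \<sqsubseteq> u"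
  shows "\<exists>A\<subseteq>X. y = \<Squnion>A"
proof (intro exI conjI)
  show "{x \<in> X. x \<sqsubseteq> y} \<subseteq> X" by blast
  show "y = \<Squnion>{x \<in> X. x \<sqsubseteq> y}"
    by (rule sup_eqI[symmetric]) (use assms in auto)
qed

text \<open>
  Distributivity makes the meet of two joins a join of binary meets, so once a generating set
  is closed under finite meets only joins remain to be added.
\<close>

lemma subframe_generated_meet_closed:
  assumes X: "X \<subseteq> carrier L" and top: "\<top> \<in> X"
    and meet: "\<And>x y. x \<in> X \<Longrightarrow> y \<in> X \<Longrightarrow> x \<sqinter> y \<in> X"
  shows "subframe_generated L X = {\<Squnion>A | A. A \<subseteq> X}"
proof
  have closed: "\<Squnion>A \<in> carrier L" if "A \<subseteq> X" for A
    using that X by (metis subset_trans sup_closed)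
  have upper: "\<Squnion>A \<sqsubseteq> u" if "A \<subseteq> X" "u \<in> carrier L" "\<And>x. x \<in> X \<Longrightarrow> x \<sqsubseteq> \<Squnion>A \<Longrightarrow> x \<sqsubseteq> u" for A u
  proof (rule sup_least)
    show AL: "A \<subseteq> carrier L" using that(1) X by blast
    show "x \<sqsubseteq> u" if "x \<in> A" for x
      using that sup_upper[OF AL, of x] \<open>A \<subseteq> X\<close> \<open>\<And>x. x \<in> X \<Longrightarrow> x \<sqsubseteq> \<Squnion>A \<Longrightarrow> x \<sqsubseteq> u\<close> by blast
  qed (use that in simp)
  have "subframe L {\<Squnion>A | A. A \<subseteq> X}"
    unfolding subframe_def
  proof (intro conjI ballI allI impI)
    show "{\<Squnion>A | A. A \<subseteq> X} \<subseteq> carrier L" using closed by auto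
    have "\<top> = \<Squnion>{\<top>}" by simp
    then show "\<top> \<in> {\<Squnion>A | A. A \<subseteq> X}" using top by blast
  next
    fix x y assume "x \<in> {\<Squnion>A | A. A \<subseteq> X}" "y \<in> {\<Squnion>A | A. A \<subseteq> X}"
    then obtain A B where AB: "A \<subseteq> X" "B \<subseteq> X" "x = \<Squnion>A" "y = \<Squnion>B" by blast
    have xy: "x \<in> carrier L" "y \<in> carrier L" using AB closed by auto
    have "\<exists>C\<subseteq>X. x \<sqinter> y = \<Squnion>C"
    proof (rule join_of_elements_below[OF X])
      show "x \<sqinter> y \<in> carrier L" using xy by simp
      fix u assume u: "u \<in> carrier L"
        and *: "\<And>z. z \<in> X \<Longrightarrow> z \<sqsubseteq> x \<sqinter> y \<Longrightarrow> z \<sqsubseteq> u"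
      show "x \<sqinter> y \<sqsubseteq> u"
        unfolding AB(3,4)
      proof (rule Sup_meet_Sup_le)
        show AL: "A \<subseteq> carrier L" and BL: "B \<subseteq> carrier L" using AB X by auto
        fix a b assume ab: "a \<in> A" "b \<in> B"
        have c: "a \<in> carrier L" "b \<in> carrier L" using ab AL BL by auto
        have "a \<sqsubseteq> x" "b \<sqsubseteq> y" using sup_upper AL BL ab AB by auto
        then have "a \<sqinter> b \<sqsubseteq> x \<sqinter> y"
          using c xy le_trans[OF meet_left[OF c], of x] le_trans[OF meet_right[OF c], of y]
          by (simp add: le_meet_iff)
        moreover have "a \<sqinter> b \<in> X" using meet ab AB by blast
        ultimately show "a \<sqinter> b \<sqsubseteq> u" by (intro *)
      qed (use u in auto)
    qed
    then show "x \<sqinter> y \<in> {\<Squnion>A | A. A \<subseteq> X}" by blast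
  next
    fix Z assume Z: "Z \<subseteq> {\<Squnion>A | A. A \<subseteq> X}"
    then have ZL: "Z \<subseteq> carrier L" using closed by auto
    have "\<exists>C\<subseteq>X. \<Squnion>Z = \<Squnion>C"
    proof (rule join_of_elements_below[OF X])
      show "\<Squnion>Z \<in> carrier L" using ZL by simp
      fix u assume u: "u \<in> carrier L"
        and *: "\<And>z. z \<in> X \<Longrightarrow> z \<sqsubseteq> \<Squnion>Z \<Longrightarrow> z \<sqsubseteq> u"
      show "\<Squnion>Z \<sqsubseteq> u"
      proof (rule sup_least[OF ZL u])
        fix y assume y: "y \<in> Z"
        then obtain A where A: "A \<subseteq> X" "y = \<Squnion>A" using Z by blast
        have "y \<sqsubseteq> \<Squnion>Z" using sup_upper[OF ZL y] .
        then have "z \<sqsubseteq> u" if "z \<in> X" "z \<sqsubseteq> y" for z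
          using that * le_trans[of z y "\<Squnion>Z"] X ZL y by (auto simp: subset_iff)
        then show "y \<sqsubseteq> u" using upper A u by blast
      qed
    qed
    then show "\<Squnion>Z \<in> {\<Squnion>A | A. A \<subseteq> X}" by blast
  qed
  moreover have "X \<subseteq> {\<Squnion>A | A. A \<subseteq> X}"
  proof
    fix x assume x: "x \<in> X"
    then have "x = \<Squnion>{x}" using X by (auto simp: subset_iff)
    then show "x \<in> {\<Squnion>A | A. A \<subseteq> X}" using x by blast
  qed
  ultimately show "subframe_generated L X \<subseteq> {\<Squnion>A | A. A \<subseteq> X}"
    by (rule subframe_generated_least)
  show "{\<Squnion>A | A. A \<subseteq> X} \<subseteq> subframe_generated L X"
    using subframe_subframe_generated[OF X] subset_subframe_generated[of X]
    unfolding subframe_def by blast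
qed

end

text \<open>
  A subframe of \<^term>\<open>L\<close> given as an order in its own right, possibly in a different record
  type.  Both \<^const>\<open>Sk\<close> and \<^const>\<open>coreflector\<close> produce such orders.  Joins and finite meets agree
  with those of \<^term>\<open>L\<close>, but infinite meets in general do not.
\<close>

locale subframe_order = frame L for L (structure) +
  fixes M :: "('a, 'm) gorder_scheme"
  assumes carrier_subframe: "subframe L (carrier M)"
    and eq_M: "eq M = (=)"
    and le_M: "x \<in> carrier M \<Longrightarrow> y \<in> carrier M \<Longrightarrow> le M x y \<longleftrightarrow> x \<sqsubseteq> y"
begin

lemma carrier_M: "x \<in> carrier M \<Longrightarrow> x \<in> carrier L"
  using carrier_subframe by (auto simp: subframe_def)

lemma carrier_M_subset: "carrier M \<subseteq> carrier L"
  using carrier_subframe by (auto simp: subframe_def)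

lemma closed_M:
  "\<top> \<in> carrier M" "\<bottom> \<in> carrier M"
  "x \<in> carrier M \<Longrightarrow> y \<in> carrier M \<Longrightarrow> x \<sqinter> y \<in> carrier M"
  "x \<in> carrier M \<Longrightarrow> y \<in> carrier M \<Longrightarrow> x \<squnion> y \<in> carrier M"
  "A \<subseteq> carrier M \<Longrightarrow> \<Squnion>A \<in> carrier M"
  using carrier_subframe subframe_bottom[OF carrier_subframe] subframe_join[OF carrier_subframe]
  by (auto simp: subframe_def)

lemma partial_order_M: "partial_order M"
  by unfold_locales
    (use le_trans carrier_M in \<open>auto simp: eq_M le_M le_refl intro: le_antisym\<close>)

lemma complete_lattice_M: "complete_lattice M"
proof -
  interpret M: partial_order M by (rule partial_order_M)
  have lub: "is_lub M (\<Squnion>A) A" if A: "A \<subseteq> carrier M" for A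
  proof (rule least_UpperI)
    have AL: "A \<subseteq> carrier L" using A carrier_M by auto
    show "x \<sqsubseteq>\<^bsub>M\<^esub> \<Squnion>A" if "x \<in> A" for x
      using that A closed_M(5)[OF A] sup_upper[OF AL] by (auto simp: le_M)
    show "\<Squnion>A \<sqsubseteq>\<^bsub>M\<^esub> y" if "y \<in> Upper M A" for y
    proof -
      have y: "y \<in> carrier M" "\<And>x. x \<in> A \<Longrightarrow> x \<sqsubseteq>\<^bsub>M\<^esub> y"
        using that A by (auto simp: Upper_def)
      then show ?thesis
        using A AL closed_M(5)[OF A] carrier_M by (auto simp: le_M subset_iff intro!: sup_least)
    qed
  qed (use A closed_M in auto)
  show ?thesis
  proof unfold_locales
    fix A assume A: "A \<subseteq> carrier M"
    show "\<exists>s. is_lub M s A" using lub[OF A] by blast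
    \<comment> \<open>an infinite meet of \<^term>\<open>L\<close> may leave the subframe, so it is replaced by the join of the lower bounds in \<^term>\<open>M\<close>\<close>
    have BM: "Lower M A \<subseteq> carrier M" by simp
    have "is_glb M (\<Squnion>(Lower M A)) A"
    proof (rule greatest_LowerI)
      show "\<Squnion>(Lower M A) \<sqsubseteq>\<^bsub>M\<^esub> x" if "x \<in> A" for x
        using least_le[OF lub[OF BM]] that A by (auto simp: Upper_def Lower_def)
      show "y \<sqsubseteq>\<^bsub>M\<^esub> \<Squnion>(Lower M A)" if "y \<in> Lower M A" for y
        using least_Upper_above[OF lub[OF BM]] that BM by auto
    qed (use A closed_M(5)[OF BM] in auto)
    then show "\<exists>i. is_glb M i A" by blast
  qed
qed

sublocale M: complete_lattice M
  by (rule complete_lattice_M)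

lemma Sup_M: "A \<subseteq> carrier M \<Longrightarrow> \<Squnion>\<^bsub>M\<^esub>A = \<Squnion>A"
  by (rule M.sup_eqI)
    (auto simp: closed_M le_M subset_iff carrier_M intro!: sup_upper sup_least)

lemma join_M: "x \<in> carrier M \<Longrightarrow> y \<in> carrier M \<Longrightarrow> x \<squnion>\<^bsub>M\<^esub> y = x \<squnion> y"
  by (simp add: join_def Sup_M)

lemma meet_M:
  assumes "x \<in> carrier M" "y \<in> carrier M"
  shows "x \<sqinter>\<^bsub>M\<^esub> y = x \<sqinter> y"
proof -
  have c: "x \<sqinter> y \<in> carrier M" using assms closed_M by simp
  have "\<Sqinter>\<^bsub>M\<^esub>{x, y} = x \<sqinter> y"
  proof (rule M.inf_eqI)
    show "x \<sqinter> y \<sqsubseteq>\<^bsub>M\<^esub> a" if "a \<in> {x, y}" for a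
      using that assms c meet_left meet_right carrier_M by (auto simp: le_M)
    show "u \<sqsubseteq>\<^bsub>M\<^esub> x \<sqinter> y" if "u \<in> carrier M" "\<And>a. a \<in> {x, y} \<Longrightarrow> u \<sqsubseteq>\<^bsub>M\<^esub> a" for u
      using that(1) that(2)[of x] that(2)[of y] assms c carrier_M by (auto simp: le_M le_meet_iff)
  qed (use assms c in auto)
  then show ?thesis by (simp add: meet_def)
qed

lemma bottom_M: "\<bottom>\<^bsub>M\<^esub> = \<bottom>"
  using Sup_M[of "{}"] by (simp add: sup_empty_eq M.sup_empty_eq)

lemma top_M: "\<top>\<^bsub>M\<^esub> = \<top>"
proof (rule M.le_antisym)
  show "\<top>\<^bsub>M\<^esub> \<sqsubseteq>\<^bsub>M\<^esub> \<top>" by (simp add: le_M closed_M carrier_M)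
  show "\<top> \<sqsubseteq>\<^bsub>M\<^esub> \<top>\<^bsub>M\<^esub>" using closed_M(1) by (rule M.top_higher)
qed (auto simp: closed_M)

lemma frame_M: "frame M"
proof
  fix x A assume "x \<in> carrier M" "A \<subseteq> carrier M"
  moreover from this have "(\<lambda>a. x \<sqinter>\<^bsub>M\<^esub> a) ` A = (\<lambda>a. x \<sqinter> a) ` A"
    by (auto simp: meet_M subset_iff intro!: image_cong)
  moreover have "(\<lambda>a. x \<sqinter> a) ` A \<subseteq> carrier M"
    using calculation(1,2) closed_M(3) by auto
  moreover have "A \<subseteq> carrier L" using calculation(2) carrier_M by auto
  ultimately show "x \<sqinter>\<^bsub>M\<^esub> \<Squnion>\<^bsub>M\<^esub>A = \<Squnion>\<^bsub>M\<^esub>((\<lambda>a. x \<sqinter>\<^bsub>M\<^esub> a) ` A)"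
    by (simp add: meet_M Sup_M closed_M meet_Sup_distrib carrier_M)
qed

lemma complements_M:
  assumes "a \<in> carrier M" "b \<in> carrier M"
  shows "complements M a b \<longleftrightarrow> complements L a b"
  using assms by (simp add: complements_def meet_M join_M bottom_M top_M carrier_M)

lemma subframe_M:
  assumes "K \<subseteq> carrier M"
  shows "subframe M K \<longleftrightarrow> subframe L K"
proof -
  have "x \<sqinter>\<^bsub>M\<^esub> y = x \<sqinter> y" if "x \<in> K" "y \<in> K" for x y
    using that assms by (intro meet_M) auto
  moreover have "\<Squnion>\<^bsub>M\<^esub>A = \<Squnion>A" if "A \<subseteq> K" for A
    using that assms by (intro Sup_M) auto
  ultimately show ?thesis
    using assms carrier_M_subset by (auto simp: subframe_def top_M)
qed

lemma join_generates_M: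
  assumes "S \<subseteq> carrier M"
  shows "join_generates M S K \<longleftrightarrow> join_generates L S K"
proof -
  have "\<Squnion>\<^bsub>M\<^esub>A = \<Squnion>A" if "A \<subseteq> S" for A
    using that assms by (intro Sup_M) auto
  then show ?thesis unfolding join_generates_def by metis
qed

end


section \<open>The frame of congruences\<close>

lemma frame_congruenceD:
  assumes "frame_congruence L \<theta>"
  shows congruence_carrier: "(x, y) \<in> \<theta> \<Longrightarrow> x \<in> carrier L \<and> y \<in> carrier L"
    and congruence_refl: "x \<in> carrier L \<Longrightarrow> (x, x) \<in> \<theta>"
    and congruence_sym: "(x, y) \<in> \<theta> \<Longrightarrow> (y, x) \<in> \<theta>"
    and congruence_trans: "(x, y) \<in> \<theta> \<Longrightarrow> (y, z) \<in> \<theta> \<Longrightarrow> (x, z) \<in> \<theta>"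
    and congruence_meet:
      "(x, y) \<in> \<theta> \<Longrightarrow> (x', y') \<in> \<theta> \<Longrightarrow> (x \<sqinter>\<^bsub>L\<^esub> x', y \<sqinter>\<^bsub>L\<^esub> y') \<in> \<theta>"
    and congruence_Sup: "R \<subseteq> \<theta> \<Longrightarrow> (\<Squnion>\<^bsub>L\<^esub>(fst ` R), \<Squnion>\<^bsub>L\<^esub>(snd ` R)) \<in> \<theta>"
proof -
  have eq: "equiv (carrier L) \<theta>"
    and meet: "\<forall>x y x' y'. (x, y) \<in> \<theta> \<longrightarrow> (x', y') \<in> \<theta> \<longrightarrow> (x \<sqinter>\<^bsub>L\<^esub> x', y \<sqinter>\<^bsub>L\<^esub> y') \<in> \<theta>"
    and Sup: "\<forall>R. R \<subseteq> \<theta> \<longrightarrow> (\<Squnion>\<^bsub>L\<^esub>(fst ` R), \<Squnion>\<^bsub>L\<^esub>(snd ` R)) \<in> \<theta>"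
    using assms unfolding frame_congruence_def by blast+
  have "\<theta> \<subseteq> carrier L \<times> carrier L" "refl_on (carrier L) \<theta>" "sym \<theta>" "trans \<theta>"
    using eq by (auto elim: equivE)
  then show "(x, y) \<in> \<theta> \<Longrightarrow> x \<in> carrier L \<and> y \<in> carrier L"
    "x \<in> carrier L \<Longrightarrow> (x, x) \<in> \<theta>"
    "(x, y) \<in> \<theta> \<Longrightarrow> (y, x) \<in> \<theta>"
    "(x, y) \<in> \<theta> \<Longrightarrow> (y, z) \<in> \<theta> \<Longrightarrow> (x, z) \<in> \<theta>"
    by (blast dest: refl_onD symD transD)+
  show "(x, y) \<in> \<theta> \<Longrightarrow> (x', y') \<in> \<theta> \<Longrightarrow> (x \<sqinter>\<^bsub>L\<^esub> x', y \<sqinter>\<^bsub>L\<^esub> y') \<in> \<theta>"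
    using meet by blast
  show "R \<subseteq> \<theta> \<Longrightarrow> (\<Squnion>\<^bsub>L\<^esub>(fst ` R), \<Squnion>\<^bsub>L\<^esub>(snd ` R)) \<in> \<theta>"
    using Sup by blast
qed

lemma congruence_join:
  assumes "frame_congruence L \<theta>" "(x, y) \<in> \<theta>" "(x', y') \<in> \<theta>"
  shows "(x \<squnion>\<^bsub>L\<^esub> x', y \<squnion>\<^bsub>L\<^esub> y') \<in> \<theta>"
  using congruence_Sup[OF assms(1), of "{(x, y), (x', y')}"] assms(2,3) by (simp add: join_def)

lemma frame_congruenceI:
  assumes "\<theta> \<subseteq> carrier L \<times> carrier L"
    and "\<And>x. x \<in> carrier L \<Longrightarrow> (x, x) \<in> \<theta>"
    and "\<And>x y. (x, y) \<in> \<theta> \<Longrightarrow> (y, x) \<in> \<theta>"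
    and "\<And>x y z. (x, y) \<in> \<theta> \<Longrightarrow> (y, z) \<in> \<theta> \<Longrightarrow> (x, z) \<in> \<theta>"
    and "\<And>x y x' y'. (x, y) \<in> \<theta> \<Longrightarrow> (x', y') \<in> \<theta> \<Longrightarrow> (x \<sqinter>\<^bsub>L\<^esub> x', y \<sqinter>\<^bsub>L\<^esub> y') \<in> \<theta>"
    and "\<And>R. R \<subseteq> \<theta> \<Longrightarrow> (\<Squnion>\<^bsub>L\<^esub>(fst ` R), \<Squnion>\<^bsub>L\<^esub>(snd ` R)) \<in> \<theta>"
  shows "frame_congruence L \<theta>"
  unfolding frame_congruence_def
proof (intro conjI equivI refl_onI symI transI allI impI)
  show "\<theta> \<subseteq> carrier L \<times> carrier L" by (rule assms)
qed (fact assms | assumption | erule assms | erule (1) assms)+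

context frame
begin

text \<open>
  The map \<^term>\<open>p\<close> may move the bottom element: an empty family of pairs is handled by
  reflexivity, so maps such as \<^term>\<open>\<lambda>x. a \<squnion> x\<close> are covered.
\<close>

lemma congruence_preimage:
  fixes N :: "('c, 'n) gorder_scheme"
  assumes \<rho>: "frame_congruence N \<rho>"
    and p: "\<And>x. x \<in> carrier L \<Longrightarrow> p x \<in> carrier N"
    and p_meet: "\<And>x y. x \<in> carrier L \<Longrightarrow> y \<in> carrier L \<Longrightarrow> p (x \<sqinter> y) = p x \<sqinter>\<^bsub>N\<^esub> p y"
    and p_Sup: "\<And>A. A \<subseteq> carrier L \<Longrightarrow> A \<noteq> {} \<Longrightarrow> p (\<Squnion>A) = \<Squnion>\<^bsub>N\<^esub>(p ` A)"
  shows "frame_congruence L {(x, y). x \<in> carrier L \<and> y \<in> carrier L \<and> (p x, p y) \<in> \<rho>}"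
    (is "frame_congruence L ?\<theta>")
proof (rule frame_congruenceI)
  fix R assume R: "R \<subseteq> ?\<theta>"
  then have fs: "fst ` R \<subseteq> carrier L" "snd ` R \<subseteq> carrier L" by auto
  show "(\<Squnion>(fst ` R), \<Squnion>(snd ` R)) \<in> ?\<theta>"
  proof (cases "R = {}")
    case True
    then show ?thesis using congruence_refl[OF \<rho>] p by simp
  next
    case False
    have "map_prod p p ` R \<subseteq> \<rho>" using R by auto
    from congruence_Sup[OF \<rho> this]
    have "(\<Squnion>\<^bsub>N\<^esub>(p ` (fst ` R)), \<Squnion>\<^bsub>N\<^esub>(p ` (snd ` R))) \<in> \<rho>"
      by (simp add: image_image)
    then show ?thesis using False fs by (simp add: p_Sup)
  qed
next
  show "(x, z) \<in> ?\<theta>" if "(x, y) \<in> ?\<theta>" "(y, z) \<in> ?\<theta>" for x y z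
    using that congruence_trans[OF \<rho>, of "p x" "p y" "p z"] by simp
  show "(x \<sqinter> x', y \<sqinter> y') \<in> ?\<theta>" if "(x, y) \<in> ?\<theta>" "(x', y') \<in> ?\<theta>" for x y x' y'
    using that congruence_meet[OF \<rho>, of "p x" "p y" "p x'" "p y'"] by (simp add: p_meet)
qed (use congruence_refl[OF \<rho>] congruence_sym[OF \<rho>] p in auto)

lemma congruence_le_total: "frame_congruence L \<theta> \<Longrightarrow> \<theta> \<subseteq> carrier L \<times> carrier L"
  using congruence_carrier[of L \<theta>] by (auto intro!: subrelI)

lemma congruence_total: "frame_congruence L (carrier L \<times> carrier L)"
proof (rule frame_congruenceI)
  fix R :: "('a \<times> 'a) set" assume "R \<subseteq> carrier L \<times> carrier L"
  then have "fst ` R \<subseteq> carrier L" "snd ` R \<subseteq> carrier L" by auto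
  then show "(\<Squnion>(fst ` R), \<Squnion>(snd ` R)) \<in> carrier L \<times> carrier L" by simp
qed auto

lemma congruence_Id: "frame_congruence L (Id_on (carrier L))"
proof (rule frame_congruenceI)
  fix R :: "('a \<times> 'a) set" assume R: "R \<subseteq> Id_on (carrier L)"
  then have "fst ` R \<subseteq> carrier L" by auto
  moreover have "snd ` R = fst ` R" using R by (intro image_cong) auto
  ultimately show "(\<Squnion>(fst ` R), \<Squnion>(snd ` R)) \<in> Id_on (carrier L)" by auto
qed auto

lemma congruence_Inter:
  assumes "\<Theta> \<noteq> {}" "\<And>\<theta>. \<theta> \<in> \<Theta> \<Longrightarrow> frame_congruence L \<theta>"
  shows "frame_congruence L (\<Inter>\<Theta>)"
proof (rule frame_congruenceI)
  show "\<Inter>\<Theta> \<subseteq> carrier L \<times> carrier L"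
  proof (rule subrelI)
    fix x y assume "(x, y) \<in> \<Inter>\<Theta>"
    then show "(x, y) \<in> carrier L \<times> carrier L"
      using assms congruence_carrier[of L _ x y] by blast
  qed
  show "(x, x) \<in> \<Inter>\<Theta>" if "x \<in> carrier L" for x
    using that assms congruence_refl[of L] by blast
  show "(y, x) \<in> \<Inter>\<Theta>" if "(x, y) \<in> \<Inter>\<Theta>" for x y
    using that assms congruence_sym[of L _ x y] by blast
  show "(x, z) \<in> \<Inter>\<Theta>" if "(x, y) \<in> \<Inter>\<Theta>" "(y, z) \<in> \<Inter>\<Theta>" for x y z
    using that assms congruence_trans[of L _ x y z] by blast
  show "(x \<sqinter> x', y \<sqinter> y') \<in> \<Inter>\<Theta>" if "(x, y) \<in> \<Inter>\<Theta>" "(x', y') \<in> \<Inter>\<Theta>" for x y x' y'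
    using that assms congruence_meet[of L _ x y x' y'] by blast
  show "(\<Squnion>(fst ` R), \<Squnion>(snd ` R)) \<in> \<Inter>\<Theta>" if "R \<subseteq> \<Inter>\<Theta>" for R
    using that assms congruence_Sup[of L _ R] by blast
qed

lemma congruence_Int:
  "frame_congruence L \<theta> \<Longrightarrow> frame_congruence L \<phi> \<Longrightarrow> frame_congruence L (\<theta> \<inter> \<phi>)"
  using congruence_Inter[of "{\<theta>, \<phi>}"] by auto

text \<open>
  A congruence is determined by its comparable pairs, because \<open>x\<close> and \<open>y\<close> are related
  iff both are related to \<open>x \<sqinter> y\<close>.
\<close>

lemma congruence_subset_iff:
  assumes "frame_congruence L \<theta>" "frame_congruence L \<phi>"
  shows "\<theta> \<subseteq> \<phi> \<longleftrightarrow> (\<forall>x y. (x, y) \<in> \<theta> \<longrightarrow> x \<sqsubseteq> y \<longrightarrow> (x, y) \<in> \<phi>)"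
proof
  assume *: "\<forall>x y. (x, y) \<in> \<theta> \<longrightarrow> x \<sqsubseteq> y \<longrightarrow> (x, y) \<in> \<phi>"
  show "\<theta> \<subseteq> \<phi>"
  proof (rule subrelI)
    fix x y assume xy: "(x, y) \<in> \<theta>"
    then have c: "x \<in> carrier L" "y \<in> carrier L" using congruence_carrier[OF assms(1)] by auto
    have "(x \<sqinter> x, y \<sqinter> x) \<in> \<theta>" "(x \<sqinter> y, y \<sqinter> y) \<in> \<theta>"
      using xy c congruence_refl[OF assms(1)] congruence_meet[OF assms(1)] by auto
    then have "(x \<sqinter> y, x) \<in> \<theta>" "(x \<sqinter> y, y) \<in> \<theta>"
      using c congruence_sym[OF assms(1)] le_iff_join[of x x] le_iff_join[of y y]
      by (auto simp: le_refl meet_comm)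
    then have "(x \<sqinter> y, x) \<in> \<phi>" "(x \<sqinter> y, y) \<in> \<phi>"
      using * c meet_left meet_right by auto
    then show "(x, y) \<in> \<phi>"
      using congruence_sym[OF assms(2), of "x \<sqinter> y" x] congruence_trans[OF assms(2), of x "x \<sqinter> y" y] by blast
  qed
qed blast

lemma carrier_congruence_frame [simp]:
  "\<theta> \<in> carrier (congruence_frame L) \<longleftrightarrow> frame_congruence L \<theta>"
  by (simp add: congruence_frame_def)

lemma le_congruence_frame [simp]: "le (congruence_frame L) = (\<subseteq>)"
  by (simp add: congruence_frame_def)

lemma partial_order_congruence_frame: "partial_order (congruence_frame L)"
  by unfold_locales (auto simp: congruence_frame_def)

lemma complete_lattice_congruence_frame: "complete_lattice (congruence_frame L)"
proof -
  interpret C: partial_order "congruence_frame L" by (rule partial_order_congruence_frame)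
  show ?thesis
  proof (rule C.complete_lattice_criterion1)
    have "greatest (congruence_frame L) (carrier L \<times> carrier L) (carrier (congruence_frame L))"
      using congruence_total congruence_le_total by (auto simp: greatest_def)
    then show "\<exists>g. greatest (congruence_frame L) g (carrier (congruence_frame L))" by blast
    fix \<Theta> assume \<Theta>: "\<Theta> \<subseteq> carrier (congruence_frame L)" "\<Theta> \<noteq> {}"
    have cong: "frame_congruence L \<theta>" if "\<theta> \<in> \<Theta>" for \<theta>
      using subsetD[OF \<Theta>(1) that] by simp
    have "is_glb (congruence_frame L) (\<Inter>\<Theta>) \<Theta>"
    proof (rule greatest_LowerI)
      show "\<phi> \<sqsubseteq>\<^bsub>congruence_frame L\<^esub> \<Inter>\<Theta>" if "\<phi> \<in> Lower (congruence_frame L) \<Theta>" for \<phi>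
        using Lower_memD[OF that _ \<Theta>(1)] by (simp add: le_Inf_iff)
      show "\<Inter>\<Theta> \<in> carrier (congruence_frame L)"
        using congruence_Inter[OF \<Theta>(2) cong] by simp
    qed (use \<Theta>(1) in auto)
    then show "\<exists>i. is_glb (congruence_frame L) i \<Theta>" by blast
  qed
qed

lemma congruence_frame_meet:
  assumes "frame_congruence L \<theta>" "frame_congruence L \<phi>"
  shows "\<theta> \<sqinter>\<^bsub>congruence_frame L\<^esub> \<phi> = \<theta> \<inter> \<phi>"
proof -
  interpret C: complete_lattice "congruence_frame L" by (rule complete_lattice_congruence_frame)
  have "\<Sqinter>\<^bsub>congruence_frame L\<^esub>{\<theta>, \<phi>} = \<theta> \<inter> \<phi>"
    by (rule C.inf_eqI) (use assms congruence_Int in auto)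
  then show ?thesis by (simp add: meet_def)
qed

lemma congruence_frame_top: "\<top>\<^bsub>congruence_frame L\<^esub> = carrier L \<times> carrier L"
proof -
  interpret C: complete_lattice "congruence_frame L" by (rule complete_lattice_congruence_frame)
  show ?thesis
    using C.top_higher[of "carrier L \<times> carrier L"] congruence_total C.top_closed
      congruence_le_total[of "\<top>\<^bsub>congruence_frame L\<^esub>"] by simp
qed

lemma congruence_frame_bottom: "\<bottom>\<^bsub>congruence_frame L\<^esub> = Id_on (carrier L)"
proof -
  interpret C: complete_lattice "congruence_frame L" by (rule complete_lattice_congruence_frame)
  show ?thesis
    using C.bottom_lower[of "Id_on (carrier L)"] congruence_Id C.bottom_closed
      congruence_refl[of L "\<bottom>\<^bsub>congruence_frame L\<^esub>"] by auto
qed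

text \<open>
  The Heyting implication of congruences, which turns distributivity of meets over joins
  into an adjunction.  It relates \<open>x\<close> and \<open>y\<close> when clamping both to any interval with
  \<open>\<theta>\<close>-related end points makes them \<open>\<rho>\<close>-related.
\<close>

definition congruence_imp :: "('a \<times> 'a) set \<Rightarrow> ('a \<times> 'a) set \<Rightarrow> ('a \<times> 'a) set" where
  "congruence_imp \<theta> \<rho> = {(x, y). x \<in> carrier L \<and> y \<in> carrier L \<and>
     (\<forall>u v. (u, v) \<in> \<theta> \<longrightarrow> u \<sqsubseteq> v \<longrightarrow> ((x \<squnion> u) \<sqinter> v, (y \<squnion> u) \<sqinter> v) \<in> \<rho>)}"

lemma congruence_congruence_imp:
  assumes \<theta>: "frame_congruence L \<theta>" and \<rho>: "frame_congruence L \<rho>"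
  shows "frame_congruence L (congruence_imp \<theta> \<rho>)"
proof -
  define E where "E u v = {(x, y). x \<in> carrier L \<and> y \<in> carrier L \<and>
      ((x \<squnion> u) \<sqinter> v, (y \<squnion> u) \<sqinter> v) \<in> \<rho>}" for u v
  \<comment> \<open>clamping preserves binary meets and nonempty joins, so it pulls \<^term>\<open>\<rho>\<close> back to a congruence\<close>
  have E: "frame_congruence L (E u v)" if uv: "u \<in> carrier L" "v \<in> carrier L" for u v
    unfolding E_def
  proof (rule congruence_preimage[OF \<rho>])
    show "(x \<squnion> u) \<sqinter> v \<in> carrier L" if "x \<in> carrier L" for x using that uv by simp
    show "(x \<sqinter> y \<squnion> u) \<sqinter> v = ((x \<squnion> u) \<sqinter> v) \<sqinter> ((y \<squnion> u) \<sqinter> v)"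
      if xy: "x \<in> carrier L" "y \<in> carrier L" for x y
    proof (rule le_antisym)
      have "x \<sqinter> y \<squnion> u = (x \<squnion> u) \<sqinter> (y \<squnion> u)"
        using xy uv join_meet_distrib[of u x y] by (simp add: join_comm)
      then show "(x \<sqinter> y \<squnion> u) \<sqinter> v \<sqsubseteq> ((x \<squnion> u) \<sqinter> v) \<sqinter> ((y \<squnion> u) \<sqinter> v)"
        "((x \<squnion> u) \<sqinter> v) \<sqinter> ((y \<squnion> u) \<sqinter> v) \<sqsubseteq> (x \<sqinter> y \<squnion> u) \<sqinter> v"
        using xy uv
        by (simp_all add: le_meet_iff meet_right meet_left le_trans[OF meet_left]
            le_trans[OF meet_left meet_left] le_trans[OF meet_left meet_right]
            le_trans[OF meet_right meet_left] le_trans[OF meet_right meet_right])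
    qed (use xy uv in auto)
    show "(\<Squnion>A \<squnion> u) \<sqinter> v = \<Squnion>((\<lambda>x. (x \<squnion> u) \<sqinter> v) ` A)"
      if A: "A \<subseteq> carrier L" "A \<noteq> {}" for A
    proof -
      have "(\<lambda>x. x \<squnion> u) ` A \<subseteq> carrier L" using A uv by auto
      then show ?thesis
        using join_Sup_distrib[OF uv(1) A] Sup_meet_distrib[OF uv(2), of "(\<lambda>x. x \<squnion> u) ` A"]
        by (simp add: join_comm image_image)
    qed
  qed
  \<comment> \<open>the total relation keeps the family nonempty and bounds it by the carrier\<close>
  have "congruence_imp \<theta> \<rho> = \<Inter>(insert (carrier L \<times> carrier L) {E u v | u v. (u, v) \<in> \<theta> \<and> u \<sqsubseteq> v})"
    by (auto simp: congruence_imp_def E_def)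
  also have "frame_congruence L \<dots>"
    using congruence_total E congruence_carrier[OF \<theta>] by (intro congruence_Inter) auto
  finally show ?thesis .
qed

text \<open>
  Clamping \<^term>\<open>x\<close> to an interval from \<^term>\<open>u\<close> to \<^term>\<open>v\<close> whose end points are
  \<^term>\<open>\<theta>\<close>-related yields an element \<^term>\<open>\<theta>\<close>-related to \<^term>\<open>u\<close>, so any two clamped elements
  are \<^term>\<open>\<theta>\<close>-related.  Conversely a comparable pair in \<^term>\<open>\<theta>\<close> is its own clamping to the interval
  between its components.
\<close>

lemma subset_congruence_imp_iff:
  assumes \<theta>: "frame_congruence L \<theta>" and \<rho>: "frame_congruence L \<rho>" and \<phi>: "frame_congruence L \<phi>"
  shows "\<phi> \<subseteq> congruence_imp \<theta> \<rho> \<longleftrightarrow> \<theta> \<inter> \<phi> \<subseteq> \<rho>"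
proof
  assume le: "\<phi> \<subseteq> congruence_imp \<theta> \<rho>"
  show "\<theta> \<inter> \<phi> \<subseteq> \<rho>"
    unfolding congruence_subset_iff[OF congruence_Int[OF \<theta> \<phi>] \<rho>]
  proof (intro allI impI)
    fix x y assume xy: "(x, y) \<in> \<theta> \<inter> \<phi>" "x \<sqsubseteq> y"
    then have c: "x \<in> carrier L" "y \<in> carrier L" using congruence_carrier[OF \<theta>] by auto
    have "((x \<squnion> x) \<sqinter> y, (y \<squnion> x) \<sqinter> y) \<in> \<rho>"
      using xy le unfolding congruence_imp_def by blast
    moreover have "x \<squnion> x = x" "x \<sqinter> y = x" "y \<squnion> x = y" "y \<sqinter> y = y"
      using c xy le_iff_join_eq[of x x] le_iff_join[of x y] le_iff_join_eq[of x y] le_iff_join[of y y]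
      by (auto simp: le_refl)
    ultimately show "(x, y) \<in> \<rho>" by simp
  qed
next
  assume le: "\<theta> \<inter> \<phi> \<subseteq> \<rho>"
  show "\<phi> \<subseteq> congruence_imp \<theta> \<rho>"
  proof (rule subrelI)
    fix x y assume xy: "(x, y) \<in> \<phi>"
    then have c: "x \<in> carrier L" "y \<in> carrier L" using congruence_carrier[OF \<phi>] by auto
    have "((x \<squnion> u) \<sqinter> v, (y \<squnion> u) \<sqinter> v) \<in> \<rho>" if uv: "(u, v) \<in> \<theta>" "u \<sqsubseteq> v" for u v
    proof -
      have c': "u \<in> carrier L" "v \<in> carrier L" using uv congruence_carrier[OF \<theta>] by auto
      have clamp: "((z \<squnion> u) \<sqinter> v, u) \<in> \<theta>" if z: "z \<in> carrier L" for z
      proof -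
        have "((z \<squnion> u) \<sqinter> u, (z \<squnion> u) \<sqinter> v) \<in> \<theta>"
          using congruence_meet[OF \<theta> congruence_refl[OF \<theta>] uv(1)] z c' by simp
        moreover have "(z \<squnion> u) \<sqinter> u = u"
          using z c' le_iff_join[of u "z \<squnion> u"] by (simp add: join_right meet_comm)
        ultimately show ?thesis
          using congruence_sym[OF \<theta>, of "(z \<squnion> u) \<sqinter> u" "(z \<squnion> u) \<sqinter> v"] by simp
      qed
      have "((x \<squnion> u) \<sqinter> v, (y \<squnion> u) \<sqinter> v) \<in> \<theta>"
        using congruence_trans[OF \<theta> clamp[OF c(1)] congruence_sym[OF \<theta> clamp[OF c(2)]]] .
      moreover have "((x \<squnion> u) \<sqinter> v, (y \<squnion> u) \<sqinter> v) \<in> \<phi>"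
        using xy c' by (intro congruence_meet[OF \<phi>] congruence_join[OF \<phi>] congruence_refl[OF \<phi>])
      ultimately show ?thesis using le by blast
    qed
    then show "(x, y) \<in> congruence_imp \<theta> \<rho>" using c by (auto simp: congruence_imp_def)
  qed
qed

lemma frame_congruence_frame: "frame (congruence_frame L)"
proof -
  interpret C: complete_lattice "congruence_frame L" by (rule complete_lattice_congruence_frame)
  show ?thesis
  proof
    fix \<theta> \<Phi> assume \<theta>: "\<theta> \<in> carrier (congruence_frame L)" and \<Phi>: "\<Phi> \<subseteq> carrier (congruence_frame L)"
    have im: "(\<lambda>\<phi>. \<theta> \<sqinter>\<^bsub>congruence_frame L\<^esub> \<phi>) ` \<Phi> \<subseteq> carrier (congruence_frame L)"
      using \<theta> \<Phi> C.meet_closed by blast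
    show "\<theta> \<sqinter>\<^bsub>congruence_frame L\<^esub> \<Squnion>\<^bsub>congruence_frame L\<^esub>\<Phi> =
        \<Squnion>\<^bsub>congruence_frame L\<^esub>((\<lambda>\<phi>. \<theta> \<sqinter>\<^bsub>congruence_frame L\<^esub> \<phi>) ` \<Phi>)"
    proof (rule C.eqI_upper_bounds)
      fix \<rho> assume \<rho>: "\<rho> \<in> carrier (congruence_frame L)"
      have "\<theta> \<sqinter>\<^bsub>congruence_frame L\<^esub> \<Squnion>\<^bsub>congruence_frame L\<^esub>\<Phi> \<subseteq> \<rho> \<longleftrightarrow>
          \<Squnion>\<^bsub>congruence_frame L\<^esub>\<Phi> \<subseteq> congruence_imp \<theta> \<rho>"
        using \<theta> \<rho> C.sup_closed[OF \<Phi>] by (simp add: congruence_frame_meet subset_congruence_imp_iff)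
      also have "\<dots> \<longleftrightarrow> (\<forall>\<phi>\<in>\<Phi>. \<phi> \<subseteq> congruence_imp \<theta> \<rho>)"
        using C.Sup_le_iff[OF \<Phi>, of "congruence_imp \<theta> \<rho>"] \<theta> \<rho>
        by (simp add: congruence_congruence_imp)
      also have "\<dots> \<longleftrightarrow> (\<forall>\<phi>\<in>\<Phi>. \<theta> \<sqinter>\<^bsub>congruence_frame L\<^esub> \<phi> \<subseteq> \<rho>)"
      proof (rule ball_cong[OF HOL.refl])
        fix \<phi> assume "\<phi> \<in> \<Phi>"
        then have "frame_congruence L \<phi>" using subsetD[OF \<Phi>] by simp
        then show "\<phi> \<subseteq> congruence_imp \<theta> \<rho> \<longleftrightarrow> \<theta> \<sqinter>\<^bsub>congruence_frame L\<^esub> \<phi> \<subseteq> \<rho>"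
          using \<theta> \<rho> by (simp add: congruence_frame_meet subset_congruence_imp_iff)
      qed
      also have "\<dots> \<longleftrightarrow> \<Squnion>\<^bsub>congruence_frame L\<^esub>((\<lambda>\<phi>. \<theta> \<sqinter>\<^bsub>congruence_frame L\<^esub> \<phi>) ` \<Phi>) \<subseteq> \<rho>"
        using C.Sup_le_iff[OF im \<rho>] by simp
      finally show "(\<theta> \<sqinter>\<^bsub>congruence_frame L\<^esub> \<Squnion>\<^bsub>congruence_frame L\<^esub>\<Phi> \<sqsubseteq>\<^bsub>congruence_frame L\<^esub> \<rho>) =
          (\<Squnion>\<^bsub>congruence_frame L\<^esub>((\<lambda>\<phi>. \<theta> \<sqinter>\<^bsub>congruence_frame L\<^esub> \<phi>) ` \<Phi>) \<sqsubseteq>\<^bsub>congruence_frame L\<^esub> \<rho>)"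
        by simp
    qed (use \<theta> \<Phi> im in \<open>simp_all del: carrier_congruence_frame add: C.meet_closed C.sup_closed\<close>)
  qed
qed

end


section \<open>Open and closed congruences\<close>

context frame
begin

lemma congruence_nabla: "a \<in> carrier L \<Longrightarrow> frame_congruence L (nabla L a)"
  using congruence_preimage[OF congruence_Id, of "\<lambda>x. a \<squnion> x"]
  by (simp add: nabla_def join_meet_distrib join_Sup_distrib Id_on_iff cong: conj_cong)

lemma congruence_delta: "a \<in> carrier L \<Longrightarrow> frame_congruence L (delta L a)"
proof -
  assume a: "a \<in> carrier L"
  have "a \<sqinter> (x \<sqinter> y) = (a \<sqinter> x) \<sqinter> (a \<sqinter> y)" if "x \<in> carrier L" "y \<in> carrier L" for x y
    using that a
    by (intro le_antisym)
      (simp_all add: le_meet_iff meet_left meet_right le_trans[OF meet_right meet_left]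
        le_trans[OF meet_right meet_right] le_trans[OF meet_left meet_left]
        le_trans[OF meet_left meet_right])
  then show ?thesis
    using a congruence_preimage[OF congruence_Id, of "\<lambda>x. a \<sqinter> x"]
    by (simp add: delta_def meet_Sup_distrib Id_on_iff cong: conj_cong)
qed

text \<open>
  The congruence \<^term>\<open>nabla L a \<inter> delta L s\<close> is generated by the single pair
  \<^term>\<open>(s, a \<squnion> s)\<close>: if \<open>x\<close> and \<open>y\<close> agree above \<open>a\<close> and below \<open>s\<close>, then \<open>x\<close> is
  \<open>x \<sqinter> (a \<squnion> s \<squnion> y)\<close>, the pair relates this to \<open>x \<sqinter> (s \<squnion> y)\<close>, and the latter is symmetric
  in \<open>x\<close> and \<open>y\<close>.  Taking \<open>s\<close> to be the bottom or \<open>a\<close> to be the top gives generators of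
  \<^term>\<open>nabla L a\<close> and \<^term>\<open>delta L s\<close>.
\<close>

lemma nabla_Int_delta_subset_iff:
  assumes a: "a \<in> carrier L" and s: "s \<in> carrier L" and \<theta>: "frame_congruence L \<theta>"
  shows "nabla L a \<inter> delta L s \<subseteq> \<theta> \<longleftrightarrow> (s, a \<squnion> s) \<in> \<theta>"
proof
  have "(s, a \<squnion> s) \<in> nabla L a \<inter> delta L s"
    using a s le_iff_join_eq[of a "a \<squnion> s"] le_iff_join[of s "a \<squnion> s"] le_iff_join[of s s]
    by (simp add: nabla_def delta_def join_left join_right join_comm le_refl)
  then show "nabla L a \<inter> delta L s \<subseteq> \<theta> \<Longrightarrow> (s, a \<squnion> s) \<in> \<theta>" by blast
next
  assume gen: "(s, a \<squnion> s) \<in> \<theta>"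
  show "nabla L a \<inter> delta L s \<subseteq> \<theta>"
  proof (rule subrelI)
    fix x y assume "(x, y) \<in> nabla L a \<inter> delta L s"
    then have xy: "x \<in> carrier L" "y \<in> carrier L" "a \<squnion> x = a \<squnion> y" "s \<sqinter> x = s \<sqinter> y"
      by (auto simp: nabla_def delta_def)
    have half: "(x, (s \<sqinter> x) \<squnion> (x \<sqinter> y)) \<in> \<theta>"
      if xy: "x \<in> carrier L" "y \<in> carrier L" "a \<squnion> x = a \<squnion> y" for x y
    proof -
      have "(x \<sqinter> (s \<squnion> y), x \<sqinter> (a \<squnion> s \<squnion> y)) \<in> \<theta>"
        using xy by (intro congruence_meet[OF \<theta>] congruence_join[OF \<theta>] congruence_refl[OF \<theta>] gen)
      moreover have "x \<sqsubseteq> a \<squnion> s \<squnion> y"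
      proof -
        have "a \<squnion> s \<squnion> y = a \<squnion> y \<squnion> s"
          using a s xy by (metis join_assoc join_comm)
        moreover have "x \<sqsubseteq> a \<squnion> y"
          using a xy join_right[of a x] by simp
        ultimately show ?thesis
          using a s xy le_trans[OF _ join_left[of "a \<squnion> y" s], of x] by simp
      qed
      then have "x \<sqinter> (a \<squnion> s \<squnion> y) = x"
        using a s xy le_iff_join by simp
      moreover have "x \<sqinter> (s \<squnion> y) = (s \<sqinter> x) \<squnion> (x \<sqinter> y)"
        using s xy by (simp add: meet_join_distrib meet_comm[of _ x s])
      ultimately show ?thesis using congruence_sym[OF \<theta>] by simp
    qed
    have "(x, (s \<sqinter> x) \<squnion> (x \<sqinter> y)) \<in> \<theta>" "(y, (s \<sqinter> x) \<squnion> (x \<sqinter> y)) \<in> \<theta>"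
      using half[of x y] half[of y x] xy by (simp_all add: meet_comm[of _ y x])
    then show "(x, y) \<in> \<theta>"
      using congruence_sym[OF \<theta>] congruence_trans[OF \<theta>, of x _ y] by blast
  qed
qed

lemma top_join_eq: "x \<in> carrier L \<Longrightarrow> \<top> \<squnion> x = \<top>"
  using top_join unfolding eq_is_equal .

lemma top_meet_eq: "x \<in> carrier L \<Longrightarrow> \<top> \<sqinter> x = x"
  using top_meet unfolding eq_is_equal .

lemma bottom_join_eq: "x \<in> carrier L \<Longrightarrow> \<bottom> \<squnion> x = x"
  using bottom_join unfolding eq_is_equal .

lemma bottom_meet_eq: "x \<in> carrier L \<Longrightarrow> \<bottom> \<sqinter> x = \<bottom>"
  using bottom_meet unfolding eq_is_equal .

lemma nabla_top: "nabla L \<top> = carrier L \<times> carrier L"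
  by (auto simp: nabla_def top_join_eq)

lemma delta_bottom: "delta L \<bottom> = carrier L \<times> carrier L"
  by (auto simp: delta_def bottom_meet_eq)

lemma nabla_subset_iff:
  assumes "a \<in> carrier L" "frame_congruence L \<theta>"
  shows "nabla L a \<subseteq> \<theta> \<longleftrightarrow> (\<bottom>, a) \<in> \<theta>"
proof -
  have "nabla L a \<inter> delta L \<bottom> = nabla L a"
    by (auto simp: delta_bottom nabla_def)
  then show ?thesis
    using nabla_Int_delta_subset_iff[of a \<bottom> \<theta>] assms bottom_join_eq[of a]
    by (simp add: join_comm)
qed

lemma delta_subset_iff:
  assumes "s \<in> carrier L" "frame_congruence L \<theta>"
  shows "delta L s \<subseteq> \<theta> \<longleftrightarrow> (s, \<top>) \<in> \<theta>"
proof -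
  have "nabla L \<top> \<inter> delta L s = delta L s"
    by (auto simp: nabla_top delta_def)
  then show ?thesis
    using nabla_Int_delta_subset_iff[of \<top> s \<theta>] assms top_join_eq[of s] by simp
qed

lemma nabla_le_iff:
  assumes "a \<in> carrier L" "b \<in> carrier L"
  shows "nabla L a \<subseteq> nabla L b \<longleftrightarrow> a \<sqsubseteq> b"
  using assms bottom_join_eq[of b] le_iff_join_eq[of a b]
  by (auto simp: nabla_subset_iff congruence_nabla, auto simp: nabla_def join_comm)

lemma delta_le_iff:
  assumes "a \<in> carrier L" "b \<in> carrier L"
  shows "delta L a \<subseteq> delta L b \<longleftrightarrow> b \<sqsubseteq> a"
  using assms top_meet_eq[of b] le_iff_join[of b a]
  by (auto simp: delta_subset_iff congruence_delta, auto simp: delta_def meet_comm)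

lemma nabla_inj: "inj_on (nabla L) (carrier L)"
proof (rule inj_onI)
  fix a b assume ab: "a \<in> carrier L" "b \<in> carrier L" "nabla L a = nabla L b"
  then have "a \<sqsubseteq> b" "b \<sqsubseteq> a" using nabla_le_iff[of a b] nabla_le_iff[of b a] by simp_all
  then show "a = b" using ab by (intro le_antisym)
qed

lemma nabla_meet:
  assumes ab: "a \<in> carrier L" "b \<in> carrier L"
  shows "nabla L (a \<sqinter> b) = nabla L a \<inter> nabla L b"
proof
  show "nabla L (a \<sqinter> b) \<subseteq> nabla L a \<inter> nabla L b"
    using ab by (simp add: nabla_le_iff meet_left meet_right)
  show "nabla L a \<inter> nabla L b \<subseteq> nabla L (a \<sqinter> b)"
  proof (rule subrelI)
    fix x y assume "(x, y) \<in> nabla L a \<inter> nabla L b"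
    then have "x \<in> carrier L" "y \<in> carrier L" "x \<squnion> a = y \<squnion> a" "x \<squnion> b = y \<squnion> b"
      by (auto simp: nabla_def join_comm)
    then show "(x, y) \<in> nabla L (a \<sqinter> b)"
      using ab join_meet_distrib[of x a b] join_meet_distrib[of y a b]
      by (simp add: nabla_def join_comm)
  qed
qed

lemma delta_join:
  assumes ab: "a \<in> carrier L" "b \<in> carrier L"
  shows "delta L (a \<squnion> b) = delta L a \<inter> delta L b"
proof
  show "delta L (a \<squnion> b) \<subseteq> delta L a \<inter> delta L b"
    using ab by (simp add: delta_le_iff join_left join_right)
  show "delta L a \<inter> delta L b \<subseteq> delta L (a \<squnion> b)"
  proof (rule subrelI)
    fix x y assume "(x, y) \<in> delta L a \<inter> delta L b"
    then have "x \<in> carrier L" "y \<in> carrier L" "x \<sqinter> a = y \<sqinter> a" "x \<sqinter> b = y \<sqinter> b"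
      by (auto simp: delta_def meet_comm)
    then show "(x, y) \<in> delta L (a \<squnion> b)"
      using ab meet_join_distrib[of x a b] meet_join_distrib[of y a b]
      by (simp add: delta_def meet_comm)
  qed
qed

text \<open>
  By the description of generators, the claim is that the elements related to the bottom by
  a congruence are closed under joins.
\<close>

lemma nabla_Sup:
  assumes A: "A \<subseteq> carrier L"
  shows "\<Squnion>\<^bsub>congruence_frame L\<^esub>(nabla L ` A) = nabla L (\<Squnion>A)"
proof -
  interpret C: complete_lattice "congruence_frame L" by (rule complete_lattice_congruence_frame)
  have aL: "a \<in> carrier L" if "a \<in> A" for a using A that by blast
  show ?thesis
  proof (rule C.sup_eqI)
    show "nabla L ` A \<subseteq> carrier (congruence_frame L)"
      using aL congruence_nabla by auto
    show "nabla L (\<Squnion>A) \<in> carrier (congruence_frame L)"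
      using A congruence_nabla by simp
    show "\<theta> \<sqsubseteq>\<^bsub>congruence_frame L\<^esub> nabla L (\<Squnion>A)" if "\<theta> \<in> nabla L ` A" for \<theta>
    proof -
      obtain a where a: "a \<in> A" "\<theta> = nabla L a" using \<open>\<theta> \<in> nabla L ` A\<close> by blast
      then show ?thesis
        using nabla_le_iff[of a "\<Squnion>A"] aL[of a] A sup_upper[OF A, of a] by simp
    qed
    show "nabla L (\<Squnion>A) \<sqsubseteq>\<^bsub>congruence_frame L\<^esub> \<theta>"
      if "\<theta> \<in> carrier (congruence_frame L)"
        and "\<And>\<phi>. \<phi> \<in> nabla L ` A \<Longrightarrow> \<phi> \<sqsubseteq>\<^bsub>congruence_frame L\<^esub> \<theta>" for \<theta>
    proof -
      have \<theta>: "frame_congruence L \<theta>" using that by simp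
      have sub: "(\<bottom>, a) \<in> \<theta>" if "a \<in> A" for a
        using \<open>\<And>\<phi>. \<phi> \<in> nabla L ` A \<Longrightarrow> \<phi> \<sqsubseteq>\<^bsub>congruence_frame L\<^esub> \<theta>\<close>[of "nabla L a"] that \<theta>
          nabla_subset_iff[OF aL[OF that] \<theta>] by simp
      have "(\<bottom>, \<Squnion>A) \<in> \<theta>"
      proof (cases "A = {}")
        case True
        then show ?thesis using congruence_refl[OF \<theta>] by (simp add: sup_empty_eq)
      next
        case False
        have "(\<Squnion>(fst ` ((\<lambda>a. (\<bottom>, a)) ` A)), \<Squnion>(snd ` ((\<lambda>a. (\<bottom>, a)) ` A))) \<in> \<theta>"
          using sub by (intro congruence_Sup[OF \<theta>]) auto
        moreover have "fst ` ((\<lambda>a. (\<bottom>, a)) ` A) = {\<bottom>}" "snd ` ((\<lambda>a. (\<bottom>, a)) ` A) = A"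
          using False by (auto simp: image_image)
        ultimately show ?thesis by simp
      qed
      then show ?thesis using nabla_subset_iff[of "\<Squnion>A" \<theta>] A \<theta> by simp
    qed
  qed
qed

text \<open>
  Any congruence above both relates the bottom to \<^term>\<open>a\<close> and \<^term>\<open>a\<close> to the top, so it is total;
  the meet is trivial because its generator \<open>(a, a \<squnion> a)\<close> is.
\<close>

lemma complements_nabla_delta:
  assumes a: "a \<in> carrier L"
  shows "complements (congruence_frame L) (nabla L a) (delta L a)"
proof -
  interpret C: complete_lattice "congruence_frame L" by (rule complete_lattice_congruence_frame)
  have c: "frame_congruence L (nabla L a)" "frame_congruence L (delta L a)"
    using a congruence_nabla congruence_delta by auto
  have "nabla L a \<inter> delta L a \<subseteq> Id_on (carrier L)"
    using nabla_Int_delta_subset_iff[OF a a congruence_Id] a le_iff_join_eq[of a a]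
    by (simp add: le_refl Id_on_iff)
  moreover have "Id_on (carrier L) \<subseteq> nabla L a \<inter> delta L a"
    using congruence_refl c by auto
  ultimately have meet: "nabla L a \<sqinter>\<^bsub>congruence_frame L\<^esub> delta L a = \<bottom>\<^bsub>congruence_frame L\<^esub>"
    using congruence_frame_meet[OF c] congruence_frame_bottom by simp
  define \<theta> where "\<theta> = nabla L a \<squnion>\<^bsub>congruence_frame L\<^esub> delta L a"
  have \<theta>: "frame_congruence L \<theta>"
    unfolding \<theta>_def using c C.join_closed[of "nabla L a" "delta L a"] by simp
  have "nabla L a \<subseteq> \<theta>" "delta L a \<subseteq> \<theta>"
    unfolding \<theta>_def using c C.join_left[of "nabla L a" "delta L a"] C.join_right[of "nabla L a" "delta L a"]
    by simp_all
  then have "(\<bottom>, a) \<in> \<theta>" "(a, \<top>) \<in> \<theta>"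
    using a \<theta> nabla_subset_iff delta_subset_iff by auto
  then have "(\<bottom>, \<top>) \<in> \<theta>" by (rule congruence_trans[OF \<theta>])
  then have "nabla L \<top> \<subseteq> \<theta>" using \<theta> nabla_subset_iff by simp
  then have "\<theta> = \<top>\<^bsub>congruence_frame L\<^esub>"
    using congruence_le_total[OF \<theta>] by (auto simp: nabla_top congruence_frame_top)
  with meet c show ?thesis by (simp add: complements_def \<theta>_def)
qed

end


section \<open>Frame homomorphisms\<close>

lemma frame_homI:
  assumes "h \<in> carrier L \<rightarrow>\<^sub>E carrier M" "h \<top>\<^bsub>L\<^esub> = \<top>\<^bsub>M\<^esub>"
    and "\<And>x y. x \<in> carrier L \<Longrightarrow> y \<in> carrier L \<Longrightarrow> h (x \<sqinter>\<^bsub>L\<^esub> y) = h x \<sqinter>\<^bsub>M\<^esub> h y"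
    and "\<And>A. A \<subseteq> carrier L \<Longrightarrow> h (\<Squnion>\<^bsub>L\<^esub>A) = \<Squnion>\<^bsub>M\<^esub>(h ` A)"
  shows "h \<in> frame_hom L M"
  using assms by (auto simp: frame_hom_def)

lemma frame_homD:
  assumes "h \<in> frame_hom L M"
  shows frame_hom_funcset: "h \<in> carrier L \<rightarrow>\<^sub>E carrier M"
    and frame_hom_closed: "x \<in> carrier L \<Longrightarrow> h x \<in> carrier M"
    and frame_hom_top: "h \<top>\<^bsub>L\<^esub> = \<top>\<^bsub>M\<^esub>"
    and frame_hom_meet:
      "x \<in> carrier L \<Longrightarrow> y \<in> carrier L \<Longrightarrow> h (x \<sqinter>\<^bsub>L\<^esub> y) = h x \<sqinter>\<^bsub>M\<^esub> h y"
    and frame_hom_Sup: "A \<subseteq> carrier L \<Longrightarrow> h (\<Squnion>\<^bsub>L\<^esub>A) = \<Squnion>\<^bsub>M\<^esub>(h ` A)"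
    and frame_hom_join:
      "x \<in> carrier L \<Longrightarrow> y \<in> carrier L \<Longrightarrow> h (x \<squnion>\<^bsub>L\<^esub> y) = h x \<squnion>\<^bsub>M\<^esub> h y"
  using assms by (auto simp: frame_hom_def join_def)

lemma frame_hom_bottom:
  assumes "frame L" "frame M" "h \<in> frame_hom L M"
  shows "h \<bottom>\<^bsub>L\<^esub> = \<bottom>\<^bsub>M\<^esub>"
proof -
  interpret L: frame L by fact
  interpret M: frame M by fact
  show ?thesis
    using frame_hom_Sup[OF assms(3), of "{}"] by (simp add: L.sup_empty_eq M.sup_empty_eq)
qed

lemma frame_hom_complements:
  assumes "frame L" "frame M" "h \<in> frame_hom L M" "complements L a b"
  shows "complements M (h a) (h b)"
  using assms frame_hom_bottom[OF assms(1-3)] frame_hom_top[OF assms(3)]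
    frame_hom_meet[OF assms(3), of a b] frame_hom_join[OF assms(3), of a b]
    frame_hom_closed[OF assms(3)]
  by (auto simp: complements_def)

lemma frame_hom_compose:
  assumes "frame L" "h \<in> frame_hom L M" "k \<in> frame_hom M N"
  shows "compose (carrier L) k h \<in> frame_hom L N"
proof (rule frame_homI)
  interpret L: frame L by fact
  have hL: "h x \<in> carrier M" if "x \<in> carrier L" for x
    using that frame_hom_closed[OF assms(2)] by blast
  show "compose (carrier L) k h \<in> carrier L \<rightarrow>\<^sub>E carrier N"
    using hL frame_hom_closed[OF assms(3)] by (auto simp: compose_def)
  show "compose (carrier L) k h \<top>\<^bsub>L\<^esub> = \<top>\<^bsub>N\<^esub>"
    using frame_hom_top[OF assms(2)] frame_hom_top[OF assms(3)] by (simp add: compose_def)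
  show "compose (carrier L) k h (x \<sqinter>\<^bsub>L\<^esub> y) =
      compose (carrier L) k h x \<sqinter>\<^bsub>N\<^esub> compose (carrier L) k h y"
    if "x \<in> carrier L" "y \<in> carrier L" for x y
    using that hL frame_hom_meet[OF assms(2)] frame_hom_meet[OF assms(3)]
    by (simp add: compose_def)
  show "compose (carrier L) k h (\<Squnion>\<^bsub>L\<^esub>A) = \<Squnion>\<^bsub>N\<^esub>(compose (carrier L) k h ` A)"
    if A: "A \<subseteq> carrier L" for A
  proof -
    have hA: "h ` A \<subseteq> carrier M" using A hL by auto
    have im: "compose (carrier L) k h ` A = k ` (h ` A)"
      using A by (auto simp: compose_def image_image subset_iff)
    show ?thesis
      unfolding im using A frame_hom_Sup[OF assms(2) A] frame_hom_Sup[OF assms(3) hA]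
      by (simp add: compose_def)
  qed
qed

lemma frame_hom_id:
  assumes "frame L"
  shows "(\<lambda>x\<in>carrier L. x) \<in> frame_hom L L"
proof -
  interpret L: frame L by fact
  show ?thesis
  proof (rule frame_homI)
    fix A assume A: "A \<subseteq> carrier L"
    then have "(\<lambda>x\<in>carrier L. x) ` A = A" by (auto simp: subset_iff)
    with A show "(\<lambda>x\<in>carrier L. x) (\<Squnion>\<^bsub>L\<^esub>A) = \<Squnion>\<^bsub>L\<^esub>((\<lambda>x\<in>carrier L. x) ` A)" by simp
  qed auto
qed

context subframe_order
begin

lemma frame_hom_into_M:
  assumes "frame K"
  shows "h \<in> frame_hom K M \<longleftrightarrow> h \<in> frame_hom K L \<and> h ` carrier K \<subseteq> carrier M"
proof
  interpret K: frame K by fact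
  assume h: "h \<in> frame_hom K M"
  have hM: "h x \<in> carrier M" if "x \<in> carrier K" for x
    using that by (rule frame_hom_closed[OF h])
  have "h \<in> frame_hom K L"
  proof (rule frame_homI)
    show "h \<in> carrier K \<rightarrow>\<^sub>E carrier L"
      using frame_hom_funcset[OF h] carrier_M by (simp add: PiE_iff)
    show "h \<top>\<^bsub>K\<^esub> = \<top>" using frame_hom_top[OF h] top_M by simp
    show "h (x \<sqinter>\<^bsub>K\<^esub> y) = h x \<sqinter> h y" if "x \<in> carrier K" "y \<in> carrier K" for x y
      using that frame_hom_meet[OF h] meet_M hM by simp
    show "h (\<Squnion>\<^bsub>K\<^esub>A) = \<Squnion>(h ` A)" if A: "A \<subseteq> carrier K" for A
    proof -
      have "h ` A \<subseteq> carrier M" using A hM by auto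
      then show ?thesis using frame_hom_Sup[OF h A] Sup_M by simp
    qed
  qed
  with hM show "h \<in> frame_hom K L \<and> h ` carrier K \<subseteq> carrier M" by auto
next
  interpret K: frame K by fact
  assume "h \<in> frame_hom K L \<and> h ` carrier K \<subseteq> carrier M"
  then have h: "h \<in> frame_hom K L" and hM: "\<And>x. x \<in> carrier K \<Longrightarrow> h x \<in> carrier M" by auto
  show "h \<in> frame_hom K M"
  proof (rule frame_homI)
    show "h \<in> carrier K \<rightarrow>\<^sub>E carrier M"
      using frame_hom_funcset[OF h] hM by (auto simp: PiE_iff)
    show "h \<top>\<^bsub>K\<^esub> = \<top>\<^bsub>M\<^esub>" using frame_hom_top[OF h] top_M by simp
    show "h (x \<sqinter>\<^bsub>K\<^esub> y) = h x \<sqinter>\<^bsub>M\<^esub> h y" if "x \<in> carrier K" "y \<in> carrier K" for x y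
      using that frame_hom_meet[OF h] meet_M hM by simp
    show "h (\<Squnion>\<^bsub>K\<^esub>A) = \<Squnion>\<^bsub>M\<^esub>(h ` A)" if A: "A \<subseteq> carrier K" for A
    proof -
      have "h ` A \<subseteq> carrier M" using A hM by auto
      then show ?thesis using frame_hom_Sup[OF h A] Sup_M by simp
    qed
  qed
qed

lemma frame_hom_restrict_M:
  assumes "h \<in> frame_hom L K"
  shows "restrict h (carrier M) \<in> frame_hom M K"
proof (rule frame_homI)
  show "restrict h (carrier M) \<in> carrier M \<rightarrow>\<^sub>E carrier K"
    using frame_hom_closed[OF assms] carrier_M by auto
  show "restrict h (carrier M) \<top>\<^bsub>M\<^esub> = \<top>\<^bsub>K\<^esub>"
    using frame_hom_top[OF assms] by (simp add: top_M closed_M)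
  show "restrict h (carrier M) (x \<sqinter>\<^bsub>M\<^esub> y) = restrict h (carrier M) x \<sqinter>\<^bsub>K\<^esub> restrict h (carrier M) y"
    if "x \<in> carrier M" "y \<in> carrier M" for x y
    using that frame_hom_meet[OF assms] by (simp add: meet_M closed_M carrier_M)
  show "restrict h (carrier M) (\<Squnion>\<^bsub>M\<^esub>A) = \<Squnion>\<^bsub>K\<^esub>(restrict h (carrier M) ` A)"
    if A: "A \<subseteq> carrier M" for A
  proof -
    have "restrict h (carrier M) ` A = h ` A" using A by (auto simp: subset_iff)
    moreover have "A \<subseteq> carrier L" using A carrier_M by auto
    ultimately show ?thesis
      using A frame_hom_Sup[OF assms] by (simp add: Sup_M closed_M)
  qed
qed

end

section \<open>The Skula biframe of a Frith frame\<close>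

context frith_frame
begin

definition basic_congruences :: "('a \<times> 'a) set set" where
  "basic_congruences = {nabla F a \<inter> delta F s | a s. a \<in> carrier F \<and> s \<in> gens F}"

lemma gens_carrier: "s \<in> gens F \<Longrightarrow> s \<in> carrier F"
  using gens_subset by blast

lemma basicI: "a \<in> carrier F \<Longrightarrow> s \<in> gens F \<Longrightarrow> nabla F a \<inter> delta F s \<in> basic_congruences"
  unfolding basic_congruences_def by blast

lemma basicE:
  assumes "\<theta> \<in> basic_congruences"
  obtains a s where "a \<in> carrier F" "s \<in> gens F" "\<theta> = nabla F a \<inter> delta F s"
  using assms unfolding basic_congruences_def by blast

lemma basic_congruence: "\<theta> \<in> basic_congruences \<Longrightarrow> frame_congruence F \<theta>"
  by (elim basicE) (simp add: congruence_Int congruence_nabla congruence_delta gens_carrier)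

lemma nabla_basic: "a \<in> carrier F \<Longrightarrow> nabla F a \<in> basic_congruences"
  using basicI[OF _ bottom_gens, of a] congruence_le_total[OF congruence_nabla]
  by (simp add: delta_bottom Int_absorb2)

lemma delta_basic: "s \<in> gens F \<Longrightarrow> delta F s \<in> basic_congruences"
  using basicI[OF top_closed, of s] congruence_le_total[OF congruence_delta[OF gens_carrier]]
  by (simp add: nabla_top Int_absorb1)

lemma basic_Int:
  assumes "\<theta> \<in> basic_congruences" "\<phi> \<in> basic_congruences"
  shows "\<theta> \<inter> \<phi> \<in> basic_congruences"
proof -
  obtain a s where as: "a \<in> carrier F" "s \<in> gens F" "\<theta> = nabla F a \<inter> delta F s"
    using assms(1) by (rule basicE)
  obtain b t where bt: "b \<in> carrier F" "t \<in> gens F" "\<phi> = nabla F b \<inter> delta F t"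
    using assms(2) by (rule basicE)
  have "\<theta> \<inter> \<phi> = nabla F (a \<sqinter> b) \<inter> delta F (s \<squnion> t)"
    using as bt gens_carrier by (simp add: nabla_meet delta_join Int_ac)
  then show ?thesis
    using as bt join_gens by (simp add: basicI)
qed

lemma nabla_frame_eq: "nabla_frame F (carrier F) = nabla F ` carrier F"
proof -
  interpret C: frame "congruence_frame F" by (rule frame_congruence_frame)
  have nC: "nabla F ` carrier F \<subseteq> carrier (congruence_frame F)" using congruence_nabla by auto
  have "subframe (congruence_frame F) (nabla F ` carrier F)"
    unfolding subframe_def
  proof (intro conjI ballI allI impI)
    show "\<top>\<^bsub>congruence_frame F\<^esub> \<in> nabla F ` carrier F"
      using imageI[OF top_closed, of "nabla F"] unfolding congruence_frame_top nabla_top .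
    show "\<theta> \<sqinter>\<^bsub>congruence_frame F\<^esub> \<phi> \<in> nabla F ` carrier F"
      if \<theta>\<phi>: "\<theta> \<in> nabla F ` carrier F" "\<phi> \<in> nabla F ` carrier F" for \<theta> \<phi>
    proof -
      obtain a b where "a \<in> carrier F" "b \<in> carrier F" "\<theta> = nabla F a" "\<phi> = nabla F b"
        using \<theta>\<phi> by blast
      then show ?thesis
        using congruence_nabla nabla_meet[of a b, symmetric]
        by (simp add: congruence_frame_meet imageI)
    qed
    show "\<Squnion>\<^bsub>congruence_frame F\<^esub>\<Theta> \<in> nabla F ` carrier F" if \<Theta>: "\<Theta> \<subseteq> nabla F ` carrier F" for \<Theta>
    proof -
      obtain A where "A \<subseteq> carrier F" "\<Theta> = nabla F ` A"
        using \<Theta> by (auto simp: subset_image_iff)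
      then show ?thesis by (simp add: nabla_Sup imageI)
    qed
  qed (use nC in auto)
  then show ?thesis
    unfolding nabla_frame_def
    using C.subset_subframe_generated by (intro subset_antisym C.subframe_generated_least) auto
qed

lemma delta_frame_eq:
  "delta_frame F (gens F) = {\<Squnion>\<^bsub>congruence_frame F\<^esub>\<Theta> | \<Theta>. \<Theta> \<subseteq> delta F ` gens F}"
proof -
  interpret C: frame "congruence_frame F" by (rule frame_congruence_frame)
  show ?thesis
    unfolding delta_frame_def
  proof (rule C.subframe_generated_meet_closed)
    show "delta F ` gens F \<subseteq> carrier (congruence_frame F)"
      using congruence_delta gens_carrier by auto
    show "\<top>\<^bsub>congruence_frame F\<^esub> \<in> delta F ` gens F"
      using imageI[OF bottom_gens, of "delta F"] unfolding congruence_frame_top delta_bottom .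
    fix \<theta> \<phi> assume "\<theta> \<in> delta F ` gens F" "\<phi> \<in> delta F ` gens F"
    then obtain s t where "s \<in> gens F" "t \<in> gens F" "\<theta> = delta F s" "\<phi> = delta F t"
      by blast
    then show "\<theta> \<sqinter>\<^bsub>congruence_frame F\<^esub> \<phi> \<in> delta F ` gens F"
      using delta_join[of s t, symmetric] join_gens[of s t] gens_carrier congruence_delta
      by (simp add: congruence_frame_meet imageI)
  qed
qed

lemma congruences_over_eq:
  "congruences_over F (gens F) = {\<Squnion>\<^bsub>congruence_frame F\<^esub>\<Theta> | \<Theta>. \<Theta> \<subseteq> basic_congruences}"
proof -
  interpret C: frame "congruence_frame F" by (rule frame_congruence_frame)
  have bC: "basic_congruences \<subseteq> carrier (congruence_frame F)"
    using basic_congruence by auto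
  have nC: "nabla_frame F (carrier F) \<union> delta_frame F (gens F) \<subseteq> carrier (congruence_frame F)"
    unfolding nabla_frame_def delta_frame_def
    using congruence_nabla congruence_delta gens_carrier
    by (intro Un_least C.subframe_generated_closed) auto
  have eq: "subframe_generated (congruence_frame F) basic_congruences =
      {\<Squnion>\<^bsub>congruence_frame F\<^esub>\<Theta> | \<Theta>. \<Theta> \<subseteq> basic_congruences}"
  proof (rule C.subframe_generated_meet_closed[OF bC])
    show "\<top>\<^bsub>congruence_frame F\<^esub> \<in> basic_congruences"
      using nabla_basic[of \<top>] by (simp add: nabla_top congruence_frame_top)
    show "\<theta> \<sqinter>\<^bsub>congruence_frame F\<^esub> \<phi> \<in> basic_congruences"
      if "\<theta> \<in> basic_congruences" "\<phi> \<in> basic_congruences" for \<theta> \<phi>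
      using that basic_Int basic_congruence by (simp add: congruence_frame_meet)
  qed
  have "subframe_generated (congruence_frame F) basic_congruences = congruences_over F (gens F)"
  proof
    have over: "subframe (congruence_frame F) (congruences_over F (gens F))"
      unfolding congruences_over_def by (rule C.subframe_subframe_generated[OF nC])
    have sub: "nabla_frame F (carrier F) \<union> delta_frame F (gens F) \<subseteq> congruences_over F (gens F)"
      unfolding congruences_over_def by (rule C.subset_subframe_generated)
    have "basic_congruences \<subseteq> congruences_over F (gens F)"
    proof
      fix \<theta> assume "\<theta> \<in> basic_congruences"
      then obtain a s where as: "a \<in> carrier F" "s \<in> gens F" "\<theta> = nabla F a \<inter> delta F s"
        by (auto simp: basic_congruences_def)
      then have "nabla F a \<in> congruences_over F (gens F)"
        "delta F s \<in> congruences_over F (gens F)"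
        using sub C.subset_subframe_generated[of "nabla F ` carrier F"]
          C.subset_subframe_generated[of "delta F ` gens F"]
        unfolding nabla_frame_def delta_frame_def by blast+
      then have "nabla F a \<sqinter>\<^bsub>congruence_frame F\<^esub> delta F s \<in> congruences_over F (gens F)"
        using over by (auto simp: subframe_def)
      then show "\<theta> \<in> congruences_over F (gens F)"
        using as congruence_nabla congruence_delta gens_carrier by (simp add: congruence_frame_meet)
    qed
    then show "subframe_generated (congruence_frame F) basic_congruences \<subseteq> congruences_over F (gens F)"
      using over by (rule C.subframe_generated_least[rotated])
    have gen: "subframe (congruence_frame F) (subframe_generated (congruence_frame F) basic_congruences)"
      by (rule C.subframe_subframe_generated[OF bC])
    have "nabla F ` carrier F \<subseteq> subframe_generated (congruence_frame F) basic_congruences"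
      "delta F ` gens F \<subseteq> subframe_generated (congruence_frame F) basic_congruences"
      using nabla_basic delta_basic C.subset_subframe_generated[of basic_congruences] by auto
    then show "congruences_over F (gens F) \<subseteq> subframe_generated (congruence_frame F) basic_congruences"
      unfolding congruences_over_def nabla_frame_def delta_frame_def
      by (intro C.subframe_generated_least[OF gen] Un_least)
  qed
  with eq show ?thesis by simp
qed

lemma Sk_simps:
  "carrier (Sk F) = congruences_over F (gens F)" "le (Sk F) = (\<subseteq>)" "eq (Sk F) = (=)"
  "pos (Sk F) = nabla F ` carrier F" "neg (Sk F) = delta_frame F (gens F)"
  by (simp_all add: Sk_def nabla_frame_eq)

lemma subframe_order_Sk: "subframe_order (congruence_frame F) (Sk F)"
proof -
  interpret C: frame "congruence_frame F" by (rule frame_congruence_frame)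
  have nC: "nabla_frame F (carrier F) \<union> delta_frame F (gens F) \<subseteq> carrier (congruence_frame F)"
    unfolding nabla_frame_def delta_frame_def
    using congruence_nabla congruence_delta gens_carrier
    by (intro Un_least C.subframe_generated_closed) auto
  show ?thesis
    by unfold_locales
      (use C.subframe_subframe_generated[OF nC] in \<open>auto simp: Sk_simps congruences_over_def\<close>)
qed

sublocale Sk: subframe_order "congruence_frame F" "Sk F"
  by (rule subframe_order_Sk)

lemma Sk_cong: "\<theta> \<in> carrier (Sk F) \<Longrightarrow> frame_congruence F \<theta>"
  using Sk.carrier_M[of \<theta>] by simp

lemma basic_Sk: "\<theta> \<in> basic_congruences \<Longrightarrow> \<theta> \<in> carrier (Sk F)"
proof -
  interpret C: frame "congruence_frame F" by (rule frame_congruence_frame)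
  assume \<theta>: "\<theta> \<in> basic_congruences"
  then have "\<Squnion>\<^bsub>congruence_frame F\<^esub>{\<theta>} = \<theta>" using basic_congruence by simp
  then show ?thesis
    using \<theta> unfolding Sk_simps congruences_over_eq by blast
qed

lemma nabla_Sk: "a \<in> carrier F \<Longrightarrow> nabla F a \<in> carrier (Sk F)"
  by (intro basic_Sk nabla_basic)

lemma delta_Sk: "s \<in> gens F \<Longrightarrow> delta F s \<in> carrier (Sk F)"
  by (intro basic_Sk delta_basic)

lemma Sk_meet:
  "\<theta> \<in> carrier (Sk F) \<Longrightarrow> \<phi> \<in> carrier (Sk F) \<Longrightarrow> \<theta> \<sqinter>\<^bsub>Sk F\<^esub> \<phi> = \<theta> \<inter> \<phi>"
  by (simp add: Sk.meet_M congruence_frame_meet Sk_cong)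

lemma Sk_join_of_basics:
  assumes "\<theta> \<in> carrier (Sk F)"
  obtains \<Theta> where "\<Theta> \<subseteq> basic_congruences" "\<theta> = \<Squnion>\<^bsub>Sk F\<^esub>\<Theta>"
proof -
  from assms obtain \<Theta> where \<Theta>: "\<Theta> \<subseteq> basic_congruences" "\<theta> = \<Squnion>\<^bsub>congruence_frame F\<^esub>\<Theta>"
    unfolding Sk_simps congruences_over_eq by blast
  have S: "\<Theta> \<subseteq> carrier (Sk F)" using \<Theta> basic_Sk by blast
  show ?thesis by (rule that[OF \<Theta>(1)]) (simp only: \<Theta>(2) Sk.Sup_M[OF S])
qed

lemma Sk_subset_iff:
  assumes \<theta>: "\<theta> \<in> carrier (Sk F)" and \<psi>: "frame_congruence F \<psi>"
  shows "\<theta> \<subseteq> \<psi> \<longleftrightarrow> (\<forall>\<beta>\<in>basic_congruences. \<beta> \<subseteq> \<theta> \<longrightarrow> \<beta> \<subseteq> \<psi>)"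
proof
  assume *: "\<forall>\<beta>\<in>basic_congruences. \<beta> \<subseteq> \<theta> \<longrightarrow> \<beta> \<subseteq> \<psi>"
  from \<theta> obtain \<Theta> where \<Theta>: "\<Theta> \<subseteq> basic_congruences" "\<theta> = \<Squnion>\<^bsub>Sk F\<^esub>\<Theta>"
    by (rule Sk_join_of_basics)
  have S: "\<Theta> \<subseteq> carrier (Sk F)" using \<Theta> basic_Sk by blast
  then have C: "\<Theta> \<subseteq> carrier (congruence_frame F)" using Sk.carrier_M_subset by blast
  have "\<beta> \<subseteq> \<psi>" if "\<beta> \<in> \<Theta>" for \<beta>
    using that * \<Theta> Sk.M.sup_upper[OF S that] by (auto simp: Sk_simps)
  then show "\<theta> \<subseteq> \<psi>"
    unfolding \<Theta>(2) Sk.Sup_M[OF S] using Sk.Sup_le_iff[OF C, of \<psi>] \<psi> by simp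
qed blast

lemma complements_Sk:
  assumes "a \<in> carrier F" "delta F a \<in> carrier (Sk F)"
  shows "complements (Sk F) (nabla F a) (delta F a)"
  using assms complements_nabla_delta nabla_Sk by (simp add: Sk.complements_M)

lemma pos_Sk_subset: "pos (Sk F) \<subseteq> carrier (Sk F)"
  using nabla_Sk by (auto simp: Sk_simps)

lemma neg_Sk_subset: "neg (Sk F) \<subseteq> carrier (Sk F)"
proof -
  have "delta F ` gens F \<subseteq> carrier (Sk F)" using delta_Sk by blast
  then show ?thesis
    unfolding Sk_simps(5) delta_frame_def by (rule Sk.subframe_generated_least[OF Sk.carrier_subframe])
qed

lemma delta_neg: "s \<in> gens F \<Longrightarrow> delta F s \<in> neg (Sk F)"
  unfolding Sk_simps delta_frame_def using Sk.subset_subframe_generated[of "delta F ` gens F"] by blast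

lemma subframe_neg_Sk: "subframe (congruence_frame F) (neg (Sk F))"
  unfolding Sk_simps delta_frame_def
  by (rule Sk.subframe_subframe_generated) (auto simp: congruence_delta gens_carrier)

lemma subframe_pos_Sk: "subframe (congruence_frame F) (pos (Sk F))"
proof -
  have "nabla F ` carrier F \<subseteq> carrier (congruence_frame F)" by (auto simp: congruence_nabla)
  from Sk.subframe_subframe_generated[OF this] show ?thesis
    unfolding Sk_simps using nabla_frame_eq unfolding nabla_frame_def by simp
qed

lemma nabla_bicomplemented: "s \<in> gens F \<Longrightarrow> nabla F s \<in> bicomplemented_pos (Sk F)"
  using complements_Sk[of s] delta_Sk[of s] delta_neg[of s] gens_carrier[of s]
  unfolding bicomplemented_pos_def Sk_simps(4) by blast

lemma delta_bicomplemented: "s \<in> gens F \<Longrightarrow> delta F s \<in> bicomplemented_neg (Sk F)"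
proof -
  interpret S: frame "Sk F" by (rule Sk.frame_M)
  assume s: "s \<in> gens F"
  then have "complements (Sk F) (delta F s) (nabla F s)"
    using complements_Sk[of s] delta_Sk gens_carrier S.complements_sym by blast
  moreover have "nabla F s \<in> pos (Sk F)"
    using s gens_carrier unfolding Sk_simps by blast
  ultimately show ?thesis
    using delta_neg[OF s] unfolding bicomplemented_neg_def by blast
qed

text \<open>
  Elements of \<open>S\<close> supply bicomplemented elements on both sides.  Join-density of \<open>S\<close> spreads
  them over the positive part, and the negative part is generated by them under joins since
  the congruences \<open>\<Delta>\<close> of elements of \<open>S\<close> are closed under finite meets.
\<close>

theorem zero_dimensional_Sk: "zero_dimensional_biframe (Sk F)"
proof -
  interpret S: frame "Sk F" by (rule Sk.frame_M)
  show ?thesis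
  proof unfold_locales
    show "subframe (Sk F) (pos (Sk F))"
      using subframe_pos_Sk by (simp add: Sk.subframe_M[OF pos_Sk_subset])
    show "subframe (Sk F) (neg (Sk F))"
      using subframe_neg_Sk by (simp add: Sk.subframe_M[OF neg_Sk_subset])
    show "join_generates (Sk F) {\<Sqinter>\<^bsub>Sk F\<^esub>X |X. finite X \<and> X \<subseteq> pos (Sk F) \<union> neg (Sk F)} (carrier (Sk F))"
      unfolding join_generates_def
    proof
      fix \<theta> assume "\<theta> \<in> carrier (Sk F)"
      then obtain \<Theta> where \<Theta>: "\<Theta> \<subseteq> basic_congruences" "\<theta> = \<Squnion>\<^bsub>Sk F\<^esub>\<Theta>"
        by (rule Sk_join_of_basics)
      have "\<exists>X. \<beta> = \<Sqinter>\<^bsub>Sk F\<^esub>X \<and> finite X \<and> X \<subseteq> pos (Sk F) \<union> neg (Sk F)" if "\<beta> \<in> \<Theta>" for \<beta>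
      proof -
        have "\<beta> \<in> basic_congruences" using that \<Theta> by blast
        then obtain a s where as: "a \<in> carrier F" "s \<in> gens F" "\<beta> = nabla F a \<inter> delta F s"
          by (rule basicE)
        then have "\<beta> = \<Sqinter>\<^bsub>Sk F\<^esub>{nabla F a, delta F s}"
          using Sk_meet[OF nabla_Sk delta_Sk] by (simp add: meet_def)
        moreover have "{nabla F a, delta F s} \<subseteq> pos (Sk F) \<union> neg (Sk F)"
          using as delta_neg by (simp add: Sk_simps)
        ultimately show ?thesis by blast
      qed
      then have "\<Theta> \<subseteq> {\<Sqinter>\<^bsub>Sk F\<^esub>X |X. finite X \<and> X \<subseteq> pos (Sk F) \<union> neg (Sk F)}" by blast
      with \<Theta> show "\<exists>A\<subseteq>{\<Sqinter>\<^bsub>Sk F\<^esub>X |X. finite X \<and> X \<subseteq> pos (Sk F) \<union> neg (Sk F)}. \<theta> = \<Squnion>\<^bsub>Sk F\<^esub>A"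
        by blast
    qed
    show "join_generates (Sk F) (bicomplemented_pos (Sk F)) (pos (Sk F))"
      unfolding join_generates_def
    proof
      fix \<theta> assume "\<theta> \<in> pos (Sk F)"
      then obtain a where a: "a \<in> carrier F" "\<theta> = nabla F a" by (auto simp: Sk_simps)
      then obtain A where A: "A \<subseteq> gens F" "a = \<Squnion>A"
        using gens_join_dense unfolding join_generates_def by blast
      then have "A \<subseteq> carrier F" "nabla F ` A \<subseteq> carrier (Sk F)"
        using gens_carrier nabla_Sk by blast+
      then have "\<theta> = \<Squnion>\<^bsub>Sk F\<^esub>(nabla F ` A)" using a A by (simp add: Sk.Sup_M nabla_Sup)
      moreover have "nabla F ` A \<subseteq> bicomplemented_pos (Sk F)" using A nabla_bicomplemented by blast
      ultimately show "\<exists>A\<subseteq>bicomplemented_pos (Sk F). \<theta> = \<Squnion>\<^bsub>Sk F\<^esub>A" by blast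
    qed
    show "join_generates (Sk F) (bicomplemented_neg (Sk F)) (neg (Sk F))"
      unfolding join_generates_def
    proof
      fix \<theta> assume "\<theta> \<in> neg (Sk F)"
      then obtain \<Theta> where \<Theta>: "\<Theta> \<subseteq> delta F ` gens F" "\<theta> = \<Squnion>\<^bsub>congruence_frame F\<^esub>\<Theta>"
        by (auto simp: Sk_simps delta_frame_eq)
      then have "\<Theta> \<subseteq> carrier (Sk F)" using delta_Sk by blast
      then have "\<theta> = \<Squnion>\<^bsub>Sk F\<^esub>\<Theta>" using \<Theta> by (simp add: Sk.Sup_M)
      moreover have "\<Theta> \<subseteq> bicomplemented_neg (Sk F)" using \<Theta> delta_bicomplemented by blast
      ultimately show "\<exists>A\<subseteq>bicomplemented_neg (Sk F). \<theta> = \<Squnion>\<^bsub>Sk F\<^esub>A" by blast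
    qed
  qed
qed

lemma nabla_frame_hom: "(\<lambda>a\<in>carrier F. nabla F a) \<in> frame_hom F (Sk F)"
proof (rule frame_homI)
  show "(\<lambda>a\<in>carrier F. nabla F a) \<in> carrier F \<rightarrow>\<^sub>E carrier (Sk F)"
    using nabla_Sk by simp
  show "(\<lambda>a\<in>carrier F. nabla F a) \<top> = \<top>\<^bsub>Sk F\<^esub>"
    by (simp add: nabla_top Sk.top_M congruence_frame_top)
  show "(\<lambda>a\<in>carrier F. nabla F a) (x \<sqinter> y) =
      (\<lambda>a\<in>carrier F. nabla F a) x \<sqinter>\<^bsub>Sk F\<^esub> (\<lambda>a\<in>carrier F. nabla F a) y"
    if "x \<in> carrier F" "y \<in> carrier F" for x y
    using that by (simp add: Sk_meet nabla_Sk nabla_meet)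
  show "(\<lambda>a\<in>carrier F. nabla F a) (\<Squnion>A) = \<Squnion>\<^bsub>Sk F\<^esub>((\<lambda>a\<in>carrier F. nabla F a) ` A)"
    if A: "A \<subseteq> carrier F" for A
  proof -
    have "(\<lambda>a\<in>carrier F. nabla F a) ` A = nabla F ` A" using A by auto
    moreover have "nabla F ` A \<subseteq> carrier (Sk F)" using A nabla_Sk by blast
    ultimately show ?thesis using A by (simp add: Sk.Sup_M nabla_Sup)
  qed
qed

text \<open>
  The uniqueness half of the universal property: complements are unique in a frame, so the
  values at \<open>\<nabla>\<close> fix those at \<open>\<Delta>\<close>.
\<close>

lemma Sk_hom_eqI:
  assumes M: "frame M" and g: "g \<in> frame_hom (Sk F) M" and g': "g' \<in> frame_hom (Sk F) M"
    and eq: "\<And>a. a \<in> carrier F \<Longrightarrow> g (nabla F a) = g' (nabla F a)"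
  shows "g = g'"
proof -
  interpret M: frame M by fact
  have delta: "g (delta F s) = g' (delta F s)" if s: "s \<in> gens F" for s
  proof (rule M.complement_unique)
    have c: "complements (Sk F) (nabla F s) (delta F s)"
      using s by (intro complements_Sk gens_carrier delta_Sk)
    show "complements M (g (nabla F s)) (g (delta F s))"
      using frame_hom_complements[OF Sk.frame_M M g c] .
    show "complements M (g (nabla F s)) (g' (delta F s))"
      using frame_hom_complements[OF Sk.frame_M M g' c] eq[OF gens_carrier[OF s]] by simp
  qed
  have basic: "g \<beta> = g' \<beta>" if "\<beta> \<in> basic_congruences" for \<beta>
  proof -
    obtain a s where as: "a \<in> carrier F" "s \<in> gens F" "\<beta> = nabla F a \<inter> delta F s"
      using \<open>\<beta> \<in> basic_congruences\<close> by (rule basicE)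
    then have "\<beta> = nabla F a \<sqinter>\<^bsub>Sk F\<^esub> delta F s" using Sk_meet nabla_Sk delta_Sk by simp
    then show ?thesis
      using as eq delta frame_hom_meet[OF g] frame_hom_meet[OF g'] nabla_Sk delta_Sk by simp
  qed
  show ?thesis
  proof (rule PiE_ext[OF frame_hom_funcset[OF g] frame_hom_funcset[OF g']])
    fix \<theta> assume "\<theta> \<in> carrier (Sk F)"
    then obtain \<Theta> where \<Theta>: "\<Theta> \<subseteq> basic_congruences" "\<theta> = \<Squnion>\<^bsub>Sk F\<^esub>\<Theta>"
      by (rule Sk_join_of_basics)
    have S: "\<Theta> \<subseteq> carrier (Sk F)" using \<Theta> basic_Sk by blast
    have "g ` \<Theta> = g' ` \<Theta>" using \<Theta> basic by (intro image_cong) auto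
    then show "g \<theta> = g' \<theta>"
      using frame_hom_Sup[OF g S] frame_hom_Sup[OF g' S] \<Theta> by simp
  qed
qed

text \<open>
  Since \<open>\<Delta>\<close> reverses the order and is an embedding, a join in its image comes from a meet.
\<close>

lemma inf_of_delta_Sup:
  assumes P: "P \<subseteq> carrier F" and a: "a \<in> carrier F"
    and eq: "\<Squnion>\<^bsub>congruence_frame F\<^esub>(delta F ` P) = delta F a"
  shows "\<Sqinter>P = a"
proof (rule inf_eqI[OF P a])
  have D: "delta F ` P \<subseteq> carrier (congruence_frame F)" using P congruence_delta by auto
  show "a \<sqsubseteq> x" if x: "x \<in> P" for x
  proof -
    have "delta F x \<subseteq> delta F a"
      using Sk.sup_upper[OF D, of "delta F x"] x eq by simp
    then show ?thesis using delta_le_iff[of x a] x P a by auto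
  qed
  show "u \<sqsubseteq> a" if u: "u \<in> carrier F" "\<And>x. x \<in> P \<Longrightarrow> u \<sqsubseteq> x" for u
  proof -
    have "delta F x \<subseteq> delta F u" if "x \<in> P" for x
      using delta_le_iff[of x u] u that P by auto
    then have "delta F a \<subseteq> delta F u"
      using Sk.Sup_le_iff[OF D, of "delta F u"] eq congruence_delta[OF u(1)] by simp
    then show ?thesis using delta_le_iff u a by simp
  qed
qed

end

section \<open>The universal property of the Skula biframe\<close>

locale complemented_hom = frith_frame F + M: frame M
  for F :: "'a frith" (structure) and M :: "('b, 'm) gorder_scheme" +
  fixes h :: "'a \<Rightarrow> 'b"
  assumes hom: "h \<in> frame_hom F M"
    and complemented: "s \<in> gens F \<Longrightarrow> \<exists>c. complements M (h s) c"
begin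

text \<open>The kernel of \<open>h\<close> followed by the closed quotient \<open>x \<mapsto> m \<squnion> x\<close> of \<^term>\<open>M\<close>.\<close>

definition quotient_kernel :: "'b \<Rightarrow> ('a \<times> 'a) set" where
  "quotient_kernel m = {(x, y). x \<in> carrier F \<and> y \<in> carrier F \<and> (h x, h y) \<in> nabla M m}"

text \<open>
  The element \<open>h a \<sqinter> c\<close> is the only possible image of \<^term>\<open>nabla F a \<inter> delta F s\<close>, as
  \<open>c\<close> must be the image of \<^term>\<open>delta F s\<close>.
\<close>

definition pieces :: "('a \<times> 'a) set \<Rightarrow> 'b set" where
  "pieces \<theta> = {h a \<sqinter>\<^bsub>M\<^esub> c | a s c. a \<in> carrier F \<and> s \<in> gens F \<and>
     complements M (h s) c \<and> nabla F a \<inter> delta F s \<subseteq> \<theta>}"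

definition extension :: "('a \<times> 'a) set \<Rightarrow> 'b" where
  "extension = (\<lambda>\<theta>\<in>carrier (Sk F). \<Squnion>\<^bsub>M\<^esub>(pieces \<theta>))"

lemma h_closed: "a \<in> carrier F \<Longrightarrow> h a \<in> carrier M"
  by (rule frame_hom_closed[OF hom])

lemma complement_closed: "complements M (h s) c \<Longrightarrow> c \<in> carrier M"
  by (simp add: complements_def)

lemma pieces_closed: "pieces \<theta> \<subseteq> carrier M"
  using h_closed complement_closed by (auto simp: pieces_def)

lemma extension_closed: "\<theta> \<in> carrier (Sk F) \<Longrightarrow> extension \<theta> \<in> carrier M"
  using pieces_closed by (simp add: extension_def)

lemma congruence_quotient_kernel:
  assumes m: "m \<in> carrier M"
  shows "frame_congruence F (quotient_kernel m)"
  unfolding quotient_kernel_def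
  by (rule congruence_preimage[OF M.congruence_nabla[OF m]])
    (use h_closed frame_hom_meet[OF hom] frame_hom_Sup[OF hom] in auto)

lemma basic_subset_quotient_kernel_iff:
  assumes as: "a \<in> carrier F" "s \<in> gens F" and c: "complements M (h s) c" and m: "m \<in> carrier M"
  shows "nabla F a \<inter> delta F s \<subseteq> quotient_kernel m \<longleftrightarrow> h a \<sqinter>\<^bsub>M\<^esub> c \<sqsubseteq>\<^bsub>M\<^esub> m"
proof -
  have s: "s \<in> carrier F" using as gens_carrier by blast
  have hs: "h a \<in> carrier M" "h s \<in> carrier M" using as s h_closed by auto
  have "nabla F a \<inter> delta F s \<subseteq> quotient_kernel m \<longleftrightarrow> (s, a \<squnion> s) \<in> quotient_kernel m"
    using as s m by (intro nabla_Int_delta_subset_iff congruence_quotient_kernel)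
  also have "\<dots> \<longleftrightarrow> m \<squnion>\<^bsub>M\<^esub> h s = m \<squnion>\<^bsub>M\<^esub> (h a \<squnion>\<^bsub>M\<^esub> h s)"
    using as s hs by (simp add: quotient_kernel_def nabla_def frame_hom_join[OF hom])
  also have "m \<squnion>\<^bsub>M\<^esub> (h a \<squnion>\<^bsub>M\<^esub> h s) = (h s \<squnion>\<^bsub>M\<^esub> m) \<squnion>\<^bsub>M\<^esub> h a"
    using hs m M.join_assoc[of "h a" "h s" m] by (simp add: join_comm)
  also have "m \<squnion>\<^bsub>M\<^esub> h s = (h s \<squnion>\<^bsub>M\<^esub> m) \<squnion>\<^bsub>M\<^esub> h a \<longleftrightarrow> h a \<sqsubseteq>\<^bsub>M\<^esub> h s \<squnion>\<^bsub>M\<^esub> m"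
    using hs m M.le_iff_join_eq[of "h a" "h s \<squnion>\<^bsub>M\<^esub> m"] by (auto simp: join_comm)
  also have "\<dots> \<longleftrightarrow> h a \<sqinter>\<^bsub>M\<^esub> c \<sqsubseteq>\<^bsub>M\<^esub> m"
    using M.meet_complement_le_iff[OF c hs(1) m] by simp
  finally show ?thesis .
qed

text \<open>
  The extension is left adjoint to \<^const>\<open>quotient_kernel\<close>: elements of \<^term>\<open>Sk F\<close> are joins of
  basic congruences, so it suffices to compare these with the kernel.  Preservation of joins
  and the values at \<open>\<nabla>\<close> follow.
\<close>

lemma extension_le_iff:
  assumes \<theta>: "\<theta> \<in> carrier (Sk F)" and m: "m \<in> carrier M"
  shows "extension \<theta> \<sqsubseteq>\<^bsub>M\<^esub> m \<longleftrightarrow> \<theta> \<subseteq> quotient_kernel m"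
proof -
  have "extension \<theta> \<sqsubseteq>\<^bsub>M\<^esub> m \<longleftrightarrow> (\<forall>x\<in>pieces \<theta>. x \<sqsubseteq>\<^bsub>M\<^esub> m)"
    using \<theta> m M.Sup_le_iff[OF pieces_closed] by (simp add: extension_def)
  also have "\<dots> \<longleftrightarrow> (\<forall>\<beta>\<in>basic_congruences. \<beta> \<subseteq> \<theta> \<longrightarrow> \<beta> \<subseteq> quotient_kernel m)"
  proof
    assume *: "\<forall>x\<in>pieces \<theta>. x \<sqsubseteq>\<^bsub>M\<^esub> m"
    show "\<forall>\<beta>\<in>basic_congruences. \<beta> \<subseteq> \<theta> \<longrightarrow> \<beta> \<subseteq> quotient_kernel m"
    proof (intro ballI impI)
      fix \<beta> assume \<beta>: "\<beta> \<in> basic_congruences" "\<beta> \<subseteq> \<theta>"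
      from \<beta>(1) obtain a s where as: "a \<in> carrier F" "s \<in> gens F" "\<beta> = nabla F a \<inter> delta F s"
        by (rule basicE)
      obtain c where c: "complements M (h s) c" using complemented as by blast
      have "h a \<sqinter>\<^bsub>M\<^esub> c \<in> pieces \<theta>" using as c \<beta>(2) unfolding pieces_def by blast
      then show "\<beta> \<subseteq> quotient_kernel m"
        using * basic_subset_quotient_kernel_iff[OF as(1,2) c m] as(3) by blast
    qed
  next
    assume *: "\<forall>\<beta>\<in>basic_congruences. \<beta> \<subseteq> \<theta> \<longrightarrow> \<beta> \<subseteq> quotient_kernel m"
    show "\<forall>x\<in>pieces \<theta>. x \<sqsubseteq>\<^bsub>M\<^esub> m"
    proof
      fix x assume "x \<in> pieces \<theta>"
      then obtain a s c where x: "x = h a \<sqinter>\<^bsub>M\<^esub> c" "a \<in> carrier F" "s \<in> gens F"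
          "complements M (h s) c" "nabla F a \<inter> delta F s \<subseteq> \<theta>"
        unfolding pieces_def by blast
      then show "x \<sqsubseteq>\<^bsub>M\<^esub> m"
        using * basicI basic_subset_quotient_kernel_iff[OF x(2-4) m] by blast
    qed
  qed
  also have "\<dots> \<longleftrightarrow> \<theta> \<subseteq> quotient_kernel m"
    using Sk_subset_iff[OF \<theta> congruence_quotient_kernel[OF m]] by simp
  finally show ?thesis .
qed

lemma extension_nabla:
  assumes a: "a \<in> carrier F"
  shows "extension (nabla F a) = h a"
proof (rule M.eqI_upper_bounds)
  fix m assume m: "m \<in> carrier M"
  have "extension (nabla F a) \<sqsubseteq>\<^bsub>M\<^esub> m \<longleftrightarrow> (\<bottom>, a) \<in> quotient_kernel m"
    using a m by (simp add: extension_le_iff nabla_Sk nabla_subset_iff congruence_quotient_kernel)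
  also have "\<dots> \<longleftrightarrow> h a \<sqsubseteq>\<^bsub>M\<^esub> m"
    using a m h_closed M.bottom_join_eq[of m] M.le_iff_join_eq[of "h a" m]
    by (auto simp: quotient_kernel_def nabla_def join_comm
        frame_hom_bottom[OF frame_axioms M.frame_axioms hom])
  finally show "extension (nabla F a) \<sqsubseteq>\<^bsub>M\<^esub> m \<longleftrightarrow> h a \<sqsubseteq>\<^bsub>M\<^esub> m" .
qed (use a nabla_Sk extension_closed h_closed in auto)

lemma extension_mono:
  assumes "\<theta> \<in> carrier (Sk F)" "\<phi> \<in> carrier (Sk F)" "\<theta> \<subseteq> \<phi>"
  shows "extension \<theta> \<sqsubseteq>\<^bsub>M\<^esub> extension \<phi>"
  using assms extension_closed extension_le_iff[of \<phi> "extension \<phi>"]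
    extension_le_iff[of \<theta> "extension \<phi>"] M.le_refl by auto

text \<open>
  The meet of two pieces is again a piece, with complement \<open>c \<sqinter> d\<close> of \<open>h (s \<squnion> t)\<close>; this is
  where closure of \<open>S\<close> under binary joins enters.
\<close>

lemma extension_meet:
  assumes \<theta>: "\<theta> \<in> carrier (Sk F)" and \<phi>: "\<phi> \<in> carrier (Sk F)"
  shows "extension (\<theta> \<sqinter>\<^bsub>Sk F\<^esub> \<phi>) = extension \<theta> \<sqinter>\<^bsub>M\<^esub> extension \<phi>"
proof -
  have i: "\<theta> \<inter> \<phi> \<in> carrier (Sk F)"
    using Sk_meet[OF \<theta> \<phi>] Sk.M.meet_closed[OF \<theta> \<phi>] by simp
  have "extension (\<theta> \<inter> \<phi>) = extension \<theta> \<sqinter>\<^bsub>M\<^esub> extension \<phi>"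
  proof (rule M.le_antisym)
    show "extension (\<theta> \<inter> \<phi>) \<sqsubseteq>\<^bsub>M\<^esub> extension \<theta> \<sqinter>\<^bsub>M\<^esub> extension \<phi>"
      using \<theta> \<phi> i by (simp add: M.le_meet_iff extension_closed extension_mono)
    have "\<Squnion>\<^bsub>M\<^esub>(pieces \<theta>) \<sqinter>\<^bsub>M\<^esub> \<Squnion>\<^bsub>M\<^esub>(pieces \<phi>) \<sqsubseteq>\<^bsub>M\<^esub> extension (\<theta> \<inter> \<phi>)"
    proof (rule M.Sup_meet_Sup_le[OF pieces_closed pieces_closed extension_closed[OF i]])
      fix x y assume xy: "x \<in> pieces \<theta>" "y \<in> pieces \<phi>"
      from xy(1) obtain a s c where x: "x = h a \<sqinter>\<^bsub>M\<^esub> c" "a \<in> carrier F" "s \<in> gens F"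
          "complements M (h s) c" "nabla F a \<inter> delta F s \<subseteq> \<theta>"
        unfolding pieces_def by blast
      from xy(2) obtain b t d where y: "y = h b \<sqinter>\<^bsub>M\<^esub> d" "b \<in> carrier F" "t \<in> gens F"
          "complements M (h t) d" "nabla F b \<inter> delta F t \<subseteq> \<phi>"
        unfolding pieces_def by blast
      have st: "s \<in> carrier F" "t \<in> carrier F" using x y gens_carrier by auto
      have cl: "h a \<in> carrier M" "h b \<in> carrier M" "c \<in> carrier M" "d \<in> carrier M"
        using x y h_closed complement_closed by auto
      have "complements M (h (s \<squnion> t)) (c \<sqinter>\<^bsub>M\<^esub> d)"
        using M.complements_join[OF x(4) y(4)] st by (simp add: frame_hom_join[OF hom])
      moreover have "nabla F (a \<sqinter> b) \<inter> delta F (s \<squnion> t) \<subseteq> \<theta> \<inter> \<phi>"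
        using x y st by (auto simp: nabla_meet delta_join)
      ultimately have "h (a \<sqinter> b) \<sqinter>\<^bsub>M\<^esub> (c \<sqinter>\<^bsub>M\<^esub> d) \<in> pieces (\<theta> \<inter> \<phi>)"
        using x(2,3) y(2,3) join_gens[of s t] meet_closed[of a b] unfolding pieces_def by blast
      then have "h (a \<sqinter> b) \<sqinter>\<^bsub>M\<^esub> (c \<sqinter>\<^bsub>M\<^esub> d) \<sqsubseteq>\<^bsub>M\<^esub> extension (\<theta> \<inter> \<phi>)"
        using i M.sup_upper[OF pieces_closed] by (simp add: extension_def)
      moreover have "h (a \<sqinter> b) \<sqinter>\<^bsub>M\<^esub> (c \<sqinter>\<^bsub>M\<^esub> d) = x \<sqinter>\<^bsub>M\<^esub> y"
      proof -
        have "h (a \<sqinter> b) \<sqinter>\<^bsub>M\<^esub> (c \<sqinter>\<^bsub>M\<^esub> d) = h a \<sqinter>\<^bsub>M\<^esub> (h b \<sqinter>\<^bsub>M\<^esub> (c \<sqinter>\<^bsub>M\<^esub> d))"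
          using x y cl by (simp add: frame_hom_meet[OF hom] M.meet_assoc)
        also have "h b \<sqinter>\<^bsub>M\<^esub> (c \<sqinter>\<^bsub>M\<^esub> d) = c \<sqinter>\<^bsub>M\<^esub> (h b \<sqinter>\<^bsub>M\<^esub> d)"
          using cl M.meet_assoc[of "h b" c d] M.meet_assoc[of c "h b" d] by (simp add: meet_comm[of M c "h b"])
        also have "h a \<sqinter>\<^bsub>M\<^esub> (c \<sqinter>\<^bsub>M\<^esub> (h b \<sqinter>\<^bsub>M\<^esub> d)) = x \<sqinter>\<^bsub>M\<^esub> y"
          using x(1) y(1) cl by (simp add: M.meet_assoc)
        finally show ?thesis .
      qed
      ultimately show "x \<sqinter>\<^bsub>M\<^esub> y \<sqsubseteq>\<^bsub>M\<^esub> extension (\<theta> \<inter> \<phi>)" by simp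
    qed
    then show "extension \<theta> \<sqinter>\<^bsub>M\<^esub> extension \<phi> \<sqsubseteq>\<^bsub>M\<^esub> extension (\<theta> \<inter> \<phi>)"
      using \<theta> \<phi> by (simp add: extension_def)
  qed (use \<theta> \<phi> i extension_closed in auto)
  then show ?thesis using Sk_meet[OF \<theta> \<phi>] by simp
qed

theorem extension_frame_hom: "extension \<in> frame_hom (Sk F) M"
proof (rule frame_homI)
  show "extension \<in> carrier (Sk F) \<rightarrow>\<^sub>E carrier M"
    using extension_closed by (auto simp: extension_def)
  have "\<top>\<^bsub>Sk F\<^esub> = nabla F \<top>"
    by (simp add: Sk.top_M congruence_frame_top nabla_top)
  then show "extension \<top>\<^bsub>Sk F\<^esub> = \<top>\<^bsub>M\<^esub>"
    using extension_nabla[of \<top>] frame_hom_top[OF hom] by simp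
  show "extension (\<theta> \<sqinter>\<^bsub>Sk F\<^esub> \<phi>) = extension \<theta> \<sqinter>\<^bsub>M\<^esub> extension \<phi>"
    if "\<theta> \<in> carrier (Sk F)" "\<phi> \<in> carrier (Sk F)" for \<theta> \<phi>
    using that by (rule extension_meet)
  show "extension (\<Squnion>\<^bsub>Sk F\<^esub>\<Theta>) = \<Squnion>\<^bsub>M\<^esub>(extension ` \<Theta>)" if \<Theta>: "\<Theta> \<subseteq> carrier (Sk F)" for \<Theta>
  proof (rule M.eqI_upper_bounds)
    have im: "extension ` \<Theta> \<subseteq> carrier M" using \<Theta> extension_closed by blast
    then show "\<Squnion>\<^bsub>M\<^esub>(extension ` \<Theta>) \<in> carrier M" by simp
    show "extension (\<Squnion>\<^bsub>Sk F\<^esub>\<Theta>) \<in> carrier M" using \<Theta> extension_closed by simp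
    fix m assume m: "m \<in> carrier M"
    have C: "\<Theta> \<subseteq> carrier (congruence_frame F)" using \<Theta> Sk.carrier_M_subset by blast
    have "extension (\<Squnion>\<^bsub>Sk F\<^esub>\<Theta>) \<sqsubseteq>\<^bsub>M\<^esub> m \<longleftrightarrow> \<Squnion>\<^bsub>congruence_frame F\<^esub>\<Theta> \<subseteq> quotient_kernel m"
      using extension_le_iff[OF Sk.M.sup_closed[OF \<Theta>] m] Sk.Sup_M[OF \<Theta>] by simp
    also have "\<dots> \<longleftrightarrow> (\<forall>\<theta>\<in>\<Theta>. \<theta> \<subseteq> quotient_kernel m)"
      using Sk.Sup_le_iff[OF C, of "quotient_kernel m"] congruence_quotient_kernel[OF m] by simp
    also have "\<dots> \<longleftrightarrow> (\<forall>\<theta>\<in>\<Theta>. extension \<theta> \<sqsubseteq>\<^bsub>M\<^esub> m)"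
    proof (rule ball_cong[OF HOL.refl])
      show "\<theta> \<subseteq> quotient_kernel m \<longleftrightarrow> extension \<theta> \<sqsubseteq>\<^bsub>M\<^esub> m" if "\<theta> \<in> \<Theta>" for \<theta>
        using extension_le_iff[OF subsetD[OF \<Theta> that] m] by simp
    qed
    also have "\<dots> \<longleftrightarrow> \<Squnion>\<^bsub>M\<^esub>(extension ` \<Theta>) \<sqsubseteq>\<^bsub>M\<^esub> m"
      using M.Sup_le_iff[OF im m] by simp
    finally show "extension (\<Squnion>\<^bsub>Sk F\<^esub>\<Theta>) \<sqsubseteq>\<^bsub>M\<^esub> m \<longleftrightarrow> \<Squnion>\<^bsub>M\<^esub>(extension ` \<Theta>) \<sqsubseteq>\<^bsub>M\<^esub> m" .
  qed
qed

end

section \<open>The adjunction\<close>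

text \<open>
  This is what strong exactness provides.  The complement of \<^term>\<open>nabla F a\<close> can only be
  \<^term>\<open>delta F a\<close>, and membership in the negative part exhibits it as a join of
  \<^term>\<open>delta F s\<close> with \<open>s\<close> in \<open>S\<close>.
\<close>

lemma (in strongly_exact_frith_frame) bicomplemented_nabla_gens:
  assumes a: "a \<in> carrier F" and bicompl: "nabla F a \<in> bicomplemented_pos (Sk F)"
  shows "a \<in> gens F"
proof -
  interpret S: frame "Sk F" by (rule Sk.frame_M)
  from bicompl obtain \<theta> where \<theta>: "\<theta> \<in> neg (Sk F)" "complements (Sk F) (nabla F a) \<theta>"
    by (auto simp: bicomplemented_pos_def)
  then have "complements (congruence_frame F) (nabla F a) \<theta>"
    using a nabla_Sk neg_Sk_subset Sk.complements_M[of "nabla F a" \<theta>] by blast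
  then have eq: "\<theta> = delta F a"
    using Sk.complement_unique complements_nabla_delta[OF a] by blast
  obtain \<Theta> where "\<Theta> \<subseteq> delta F ` gens F" "\<theta> = \<Squnion>\<^bsub>congruence_frame F\<^esub>\<Theta>"
    using \<theta>(1) by (auto simp: Sk_simps delta_frame_eq)
  then obtain P where P: "P \<subseteq> gens F" "\<Squnion>\<^bsub>congruence_frame F\<^esub>(delta F ` P) = delta F a"
    using eq by (auto simp: subset_image_iff)
  then have "strongly_exact_meet F P"
    using a unfolding strongly_exact_meet_def by blast
  then have "\<Sqinter>P \<in> gens F" using P(1) by (intro strongly_exact)
  moreover have "\<Sqinter>P = a"
    using P a gens_subset by (intro inf_of_delta_Sup) auto
  ultimately show ?thesis by simp
qed

lemma coreflector_simps:
  "carrier (coreflector B) = pos B" "eq (coreflector B) = (=)" "le (coreflector B) = le B"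
  "gens (coreflector B) = bicomplemented_pos B"
  by (simp_all add: coreflector_def)

context zero_dimensional_biframe
begin

lemma subframe_order_coreflector: "subframe_order B (coreflector B)"
  by unfold_locales (auto simp: coreflector_simps subframe_pos)

sublocale P: subframe_order B "coreflector B"
  by (rule subframe_order_coreflector)

lemma pos_carrier: "x \<in> pos B \<Longrightarrow> x \<in> carrier B"
  using P.carrier_M by (simp add: coreflector_simps)

lemma bicomplemented_posI: "a \<in> pos B \<Longrightarrow> b \<in> neg B \<Longrightarrow> complements B a b \<Longrightarrow> a \<in> bicomplemented_pos B"
  by (auto simp: bicomplemented_pos_def)

lemma bicomplemented_posE:
  assumes "a \<in> bicomplemented_pos B"
  obtains b where "a \<in> pos B" "b \<in> neg B" "complements B a b"
  using assms by (auto simp: bicomplemented_pos_def)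

lemma frith_frame_coreflector: "frith_frame (coreflector B)"
proof -
  interpret P: frame "coreflector B" by (rule P.frame_M)
  have sub: "bicomplemented_pos B \<subseteq> pos B" by (auto simp: bicomplemented_pos_def)
  have pos_ops: "\<top> \<in> pos B" "\<bottom> \<in> pos B"
      "\<And>x y. x \<in> pos B \<Longrightarrow> y \<in> pos B \<Longrightarrow> x \<sqinter> y \<in> pos B"
      "\<And>x y. x \<in> pos B \<Longrightarrow> y \<in> pos B \<Longrightarrow> x \<squnion> y \<in> pos B"
    using P.closed_M by (simp_all add: coreflector_simps)
  have neg_ops: "\<top> \<in> neg B" "\<bottom> \<in> neg B"
      "\<And>x y. x \<in> neg B \<Longrightarrow> y \<in> neg B \<Longrightarrow> x \<sqinter> y \<in> neg B"
      "\<And>x y. x \<in> neg B \<Longrightarrow> y \<in> neg B \<Longrightarrow> x \<squnion> y \<in> neg B"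
    using subframe_neg subframe_bottom[OF subframe_neg] subframe_join[OF subframe_neg]
    by (auto simp: subframe_def)
  show ?thesis
  proof unfold_locales
    show "gens (coreflector B) \<subseteq> carrier (coreflector B)"
      using sub by (simp add: coreflector_simps)
    show "\<top>\<^bsub>coreflector B\<^esub> \<in> gens (coreflector B)"
      using bicomplemented_posI[OF pos_ops(1) neg_ops(2) complements_top_bottom]
      by (simp add: coreflector_simps P.top_M)
    show "\<bottom>\<^bsub>coreflector B\<^esub> \<in> gens (coreflector B)"
      using bicomplemented_posI[OF pos_ops(2) neg_ops(1) complements_sym[OF complements_top_bottom]]
      by (simp add: coreflector_simps P.bottom_M)
    show "join_generates (coreflector B) (gens (coreflector B)) (carrier (coreflector B))"
      using zero_dimensional_pos P.join_generates_M[of "bicomplemented_pos B"] sub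
      by (simp add: coreflector_simps)
    fix s t assume "s \<in> gens (coreflector B)" "t \<in> gens (coreflector B)"
    then have "s \<in> bicomplemented_pos B" "t \<in> bicomplemented_pos B"
      by (simp_all add: coreflector_simps)
    then obtain s' t' where st: "s \<in> pos B" "s' \<in> neg B" "complements B s s'"
        "t \<in> pos B" "t' \<in> neg B" "complements B t t'"
      by (meson bicomplemented_posE)
    show "s \<sqinter>\<^bsub>coreflector B\<^esub> t \<in> gens (coreflector B)"
      using bicomplemented_posI[OF pos_ops(3) neg_ops(4) complements_meet] st
      by (simp add: coreflector_simps P.meet_M)
    show "s \<squnion>\<^bsub>coreflector B\<^esub> t \<in> gens (coreflector B)"
      using bicomplemented_posI[OF pos_ops(4) neg_ops(3) complements_join] st
      by (simp add: coreflector_simps P.join_M)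
  qed
qed

end

locale coreflection = F: frith_frame F + A: zero_dimensional_biframe A
  for F :: "'a frith" and A :: "'b biframe_rec"
begin

lemma Sk_transpose_apply: "a \<in> carrier F \<Longrightarrow> Sk_transpose F g a = g (nabla F a)"
  by (simp add: Sk_transpose_def)

lemma Sk_transpose_frith_hom:
  assumes g: "g \<in> biframe_hom (Sk F) A"
  shows "Sk_transpose F g \<in> frith_hom F (coreflector A)"
proof -
  have gf: "g \<in> frame_hom (Sk F) A" and gp: "g ` pos (Sk F) \<subseteq> pos A" and gn: "g ` neg (Sk F) \<subseteq> neg A"
    using g by (auto simp: biframe_hom_def)
  have eq: "Sk_transpose F g = compose (carrier F) g (\<lambda>a\<in>carrier F. nabla F a)"
    by (auto simp: Sk_transpose_def compose_def)
  have "Sk_transpose F g \<in> frame_hom F A"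
    unfolding eq by (rule frame_hom_compose[OF F.frame_axioms F.nabla_frame_hom gf])
  moreover have nab: "g (nabla F a) \<in> pos A" if "a \<in> carrier F" for a
    using that gp by (auto simp: F.Sk_simps)
  then have "Sk_transpose F g ` carrier F \<subseteq> carrier (coreflector A)"
    by (auto simp: Sk_transpose_apply coreflector_simps)
  ultimately have "Sk_transpose F g \<in> frame_hom F (coreflector A)"
    using A.P.frame_hom_into_M[OF F.frame_axioms] by blast
  moreover have "Sk_transpose F g s \<in> gens (coreflector A)" if s: "s \<in> gens F" for s
  proof -
    have sc: "s \<in> carrier F" using s by (rule F.gens_carrier)
    have "complements A (g (nabla F s)) (g (delta F s))"
      using s sc F.complements_Sk F.delta_Sk
      by (intro frame_hom_complements[OF F.Sk.frame_M A.frame_axioms gf]) auto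
    moreover have "g (delta F s) \<in> neg A" using s gn F.delta_neg by blast
    ultimately show ?thesis
      using nab[OF sc] sc A.bicomplemented_posI by (simp add: Sk_transpose_apply coreflector_simps)
  qed
  ultimately show ?thesis by (auto simp: frith_hom_def)
qed

lemma Sk_transpose_inj: "inj_on (Sk_transpose F) (biframe_hom (Sk F) A)"
proof (rule inj_onI)
  fix g g' assume g: "g \<in> biframe_hom (Sk F) A" and g': "g' \<in> biframe_hom (Sk F) A"
    and eq: "Sk_transpose F g = Sk_transpose F g'"
  show "g = g'"
  proof (rule F.Sk_hom_eqI[OF A.frame_axioms])
    show "g \<in> frame_hom (Sk F) A" "g' \<in> frame_hom (Sk F) A"
      using g g' by (auto simp: biframe_hom_def)
    show "g (nabla F a) = g' (nabla F a)" if "a \<in> carrier F" for a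
      using that fun_cong[OF eq, of a] by (simp add: Sk_transpose_apply)
  qed
qed

text \<open>
  The universal property supplies a frame homomorphism; it respects the negative parts because it
  sends \<^term>\<open>delta F s\<close> to the complement of \<open>h s\<close>, which bicomplementation places in
  \<^term>\<open>neg A\<close>, a subframe.
\<close>

lemma Sk_transpose_surj:
  assumes h: "h \<in> frith_hom F (coreflector A)"
  obtains g where "g \<in> biframe_hom (Sk F) A" "Sk_transpose F g = h"
proof -
  have "h \<in> frame_hom F (coreflector A)" using h by (simp add: frith_hom_def)
  then have hA: "h \<in> frame_hom F A" and hpos: "h ` carrier F \<subseteq> pos A"
    using A.P.frame_hom_into_M[OF F.frame_axioms, of h] by (auto simp: coreflector_simps)
  have hgens: "h s \<in> bicomplemented_pos A" if "s \<in> gens F" for s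
    using h that by (auto simp: frith_hom_def coreflector_simps)
  interpret E: complemented_hom F A h
    by unfold_locales (use hA hgens in \<open>auto simp: bicomplemented_pos_def\<close>)
  note gf = E.extension_frame_hom
  have delta: "E.extension (delta F s) \<in> neg A" if s: "s \<in> gens F" for s
  proof -
    obtain c where c: "c \<in> neg A" "complements A (h s) c"
      using hgens[OF s] by (auto simp: bicomplemented_pos_def)
    have "complements A (E.extension (nabla F s)) (E.extension (delta F s))"
      using s F.gens_carrier F.complements_Sk F.delta_Sk
      by (intro frame_hom_complements[OF F.Sk.frame_M A.frame_axioms gf]) auto
    then have "complements A (h s) (E.extension (delta F s))"
      using s F.gens_carrier by (simp add: E.extension_nabla)
    then have "E.extension (delta F s) = c" using c(2) by (rule A.complement_unique)
    with c show ?thesis by simp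
  qed
  have "E.extension \<theta> \<in> neg A" if \<theta>: "\<theta> \<in> neg (Sk F)" for \<theta>
  proof -
    obtain \<Theta> where \<Theta>: "\<Theta> \<subseteq> delta F ` gens F" "\<theta> = \<Squnion>\<^bsub>congruence_frame F\<^esub>\<Theta>"
      using \<theta> by (auto simp: F.Sk_simps F.delta_frame_eq)
    have S: "\<Theta> \<subseteq> carrier (Sk F)" using \<Theta> F.delta_Sk by blast
    have "E.extension \<theta> = \<Squnion>\<^bsub>A\<^esub>(E.extension ` \<Theta>)"
      using frame_hom_Sup[OF gf S] \<Theta>(2) F.Sk.Sup_M[OF S] by simp
    moreover have "E.extension ` \<Theta> \<subseteq> neg A" using \<Theta> delta by blast
    ultimately show ?thesis using A.subframe_neg by (auto simp: subframe_def)
  qed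
  moreover have "E.extension \<theta> \<in> pos A" if "\<theta> \<in> pos (Sk F)" for \<theta>
    using that hpos by (auto simp: F.Sk_simps E.extension_nabla)
  ultimately have "E.extension \<in> biframe_hom (Sk F) A"
    using gf by (auto simp: biframe_hom_def)
  moreover have "Sk_transpose F E.extension = h"
  proof (rule ext)
    fix a
    show "Sk_transpose F E.extension a = h a"
    proof (cases "a \<in> carrier F")
      case True
      then show ?thesis by (simp add: Sk_transpose_apply E.extension_nabla)
    next
      case False
      then show ?thesis
        using PiE_arb[OF frame_hom_funcset[OF hA] False] by (simp add: Sk_transpose_def)
    qed
  qed
  ultimately show ?thesis by (rule that)
qed

theorem Sk_transpose_bij:
  "bij_betw (Sk_transpose F) (biframe_hom (Sk F) A) (frith_hom F (coreflector A))"
  unfolding bij_betw_def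
proof (intro conjI Sk_transpose_inj subset_antisym subsetI)
  show "h \<in> frith_hom F (coreflector A)" if "h \<in> Sk_transpose F ` biframe_hom (Sk F) A" for h
    using that Sk_transpose_frith_hom by blast
  show "h \<in> Sk_transpose F ` biframe_hom (Sk F) A" if h: "h \<in> frith_hom F (coreflector A)" for h
    using Sk_transpose_surj[OF h] by blast
qed

end

text \<open>
  The counit \<open>g\<close>, the transpose of the identity, carries the complementary pair
  \<^term>\<open>nabla (coreflector B) a\<close>, \<^term>\<open>delta (coreflector B) a\<close> to \<open>a\<close> and an element of
  \<^term>\<open>neg B\<close>.
\<close>

theorem (in zero_dimensional_biframe) strongly_exact_coreflector:
  "strongly_exact_frith_frame (coreflector B)"
proof -
  interpret F: frith_frame "coreflector B" by (rule frith_frame_coreflector)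
  interpret coreflection "coreflector B" B ..
  have "(\<lambda>x\<in>carrier (coreflector B). x) \<in> frith_hom (coreflector B) (coreflector B)"
    using frame_hom_id[OF F.frame_axioms] F.gens_carrier by (auto simp: frith_hom_def)
  then obtain g where g: "g \<in> biframe_hom (Sk (coreflector B)) B"
      and gt: "Sk_transpose (coreflector B) g = (\<lambda>x\<in>carrier (coreflector B). x)"
    by (rule Sk_transpose_surj)
  have gf: "g \<in> frame_hom (Sk (coreflector B)) B" and gn: "g ` neg (Sk (coreflector B)) \<subseteq> neg B"
    using g by (auto simp: biframe_hom_def)
  show ?thesis
  proof unfold_locales
    fix P assume P: "P \<subseteq> gens (coreflector B)" and "strongly_exact_meet (coreflector B) P"
    then obtain a where a: "a \<in> carrier (coreflector B)"
        and eq: "\<Squnion>\<^bsub>congruence_frame (coreflector B)\<^esub>(delta (coreflector B) ` P) = delta (coreflector B) a"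
      unfolding strongly_exact_meet_def by blast
    have neg: "delta (coreflector B) a \<in> neg (Sk (coreflector B))"
      unfolding F.Sk_simps F.delta_frame_eq eq[symmetric] using P by blast
    then have "delta (coreflector B) a \<in> carrier (Sk (coreflector B))"
      using F.neg_Sk_subset by blast
    then have "complements B (g (nabla (coreflector B) a)) (g (delta (coreflector B) a))"
      using frame_hom_complements[OF F.Sk.frame_M frame_axioms gf F.complements_Sk] a by blast
    moreover have "g (nabla (coreflector B) a) = a"
      using fun_cong[OF gt, of a] a by (simp add: Sk_transpose_apply)
    moreover have "g (delta (coreflector B) a) \<in> neg B" using gn neg by blast
    ultimately have "a \<in> bicomplemented_pos B"
      using a bicomplemented_posI by (simp add: coreflector_simps)
    moreover have "\<Sqinter>\<^bsub>coreflector B\<^esub>P = a"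
      using P F.gens_subset a eq by (intro F.inf_of_delta_Sup) auto
    ultimately show "\<Sqinter>\<^bsub>coreflector B\<^esub>P \<in> gens (coreflector B)"
      by (simp add: coreflector_simps)
  qed
qed

lemma coreflector_map_frith_hom:
  assumes A: "zero_dimensional_biframe A" and B: "zero_dimensional_biframe B"
    and f: "f \<in> biframe_hom A B"
  shows "coreflector_map A f \<in> frith_hom (coreflector A) (coreflector B)"
proof -
  interpret A: zero_dimensional_biframe A by fact
  interpret B: zero_dimensional_biframe B by fact
  have ff: "f \<in> frame_hom A B" and fp: "f ` pos A \<subseteq> pos B" and fn: "f ` neg A \<subseteq> neg B"
    using f by (auto simp: biframe_hom_def)
  have eq: "coreflector_map A f = restrict f (carrier (coreflector A))"
    by (simp add: coreflector_map_def coreflector_simps)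
  have "coreflector_map A f \<in> frame_hom (coreflector A) B"
    unfolding eq by (rule A.P.frame_hom_restrict_M[OF ff])
  moreover have "coreflector_map A f ` carrier (coreflector A) \<subseteq> carrier (coreflector B)"
    using fp by (auto simp: coreflector_map_def coreflector_simps)
  ultimately have "coreflector_map A f \<in> frame_hom (coreflector A) (coreflector B)"
    using B.P.frame_hom_into_M[OF A.P.frame_M] by blast
  moreover have "coreflector_map A f a \<in> bicomplemented_pos B" if a: "a \<in> bicomplemented_pos A" for a
  proof -
    obtain b where b: "a \<in> pos A" "b \<in> neg A" "complements A a b"
      using a by (rule A.bicomplemented_posE)
    have "complements B (f a) (f b)"
      by (rule frame_hom_complements[OF A.frame_axioms B.frame_axioms ff b(3)])
    then show ?thesis
      using b fp fn by (auto simp: coreflector_map_def intro!: B.bicomplemented_posI)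
  qed
  ultimately show ?thesis by (auto simp: frith_hom_def coreflector_simps)
qed

locale Sk_functor = F: frith_frame F + G: frith_frame G
  for F :: "'a frith" and G :: "'b frith"
begin

sublocale coreflection F "Sk G"
  by (rule coreflection.intro[OF F.frith_frame_axioms G.zero_dimensional_Sk])

lemma extends_along_nabla_unique:
  assumes "extends_along_nabla F G h g" "extends_along_nabla F G h g'"
  shows "g = g'"
  using assms unfolding extends_along_nabla_def
  by (intro F.Sk_hom_eqI[OF G.Sk.frame_M]) auto

lemma Sk_map_eqI: "extends_along_nabla F G h g \<Longrightarrow> Sk_map F G h = g"
  unfolding Sk_map_def using extends_along_nabla_unique by (intro the_equality)

text \<open>
  Following \<open>h\<close> by \<open>\<nabla>\<close> gives a morphism into the coreflector of \<^term>\<open>Sk G\<close>; its transpose is the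
  extension.
\<close>

lemma extends_along_nabla_exists:
  assumes h: "h \<in> frith_hom F G"
  obtains g where "g \<in> biframe_hom (Sk F) (Sk G)" "extends_along_nabla F G h g"
proof -
  have hf: "h \<in> frame_hom F G" and hg: "h ` gens F \<subseteq> gens G" using h by (auto simp: frith_hom_def)
  have hc: "h a \<in> carrier G" if "a \<in> carrier F" for a
    using that by (rule frame_hom_closed[OF hf])
  define t where "t = compose (carrier F) (\<lambda>a\<in>carrier G. nabla G a) h"
  have t_apply: "t a = nabla G (h a)" if "a \<in> carrier F" for a
    using that hc by (simp add: t_def compose_def)
  have "t \<in> frame_hom F (Sk G)"
    unfolding t_def by (rule frame_hom_compose[OF F.frame_axioms hf G.nabla_frame_hom])
  moreover have "t ` carrier F \<subseteq> carrier (coreflector (Sk G))"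
    using hc by (auto simp: t_apply coreflector_simps G.Sk_simps)
  ultimately have "t \<in> frame_hom F (coreflector (Sk G))"
    using A.P.frame_hom_into_M[OF F.frame_axioms] by blast
  moreover have "t s \<in> gens (coreflector (Sk G))" if s: "s \<in> gens F" for s
    using s hg G.nabla_bicomplemented F.gens_carrier by (auto simp: t_apply coreflector_simps)
  ultimately have "t \<in> frith_hom F (coreflector (Sk G))"
    by (auto simp: frith_hom_def)
  then obtain g where g: "g \<in> biframe_hom (Sk F) (Sk G)" "Sk_transpose F g = t"
    by (rule Sk_transpose_surj)
  have "g (nabla F a) = nabla G (h a)" if "a \<in> carrier F" for a
    using that g(2) t_apply Sk_transpose_apply[of a g] by simp
  then have "extends_along_nabla F G h g"
    using g(1) by (simp add: extends_along_nabla_def biframe_hom_def)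
  with g(1) show ?thesis by (rule that)
qed

lemma Sk_map_hom:
  assumes "h \<in> frith_hom F G"
  shows "extends_along_nabla F G h (Sk_map F G h)" "Sk_map F G h \<in> biframe_hom (Sk F) (Sk G)"
  using extends_along_nabla_exists[OF assms] Sk_map_eqI by metis+

lemma Sk_map_nabla:
  "h \<in> frith_hom F G \<Longrightarrow> a \<in> carrier F \<Longrightarrow> Sk_map F G h (nabla F a) = nabla G (h a)"
  using Sk_map_hom(1) by (simp add: extends_along_nabla_def)

lemma Sk_map_inj: "inj_on (Sk_map F G) (frith_hom F G)"
proof (rule inj_onI)
  fix h k assume hk: "h \<in> frith_hom F G" "k \<in> frith_hom F G" "Sk_map F G h = Sk_map F G k"
  have hf: "h \<in> frame_hom F G" "k \<in> frame_hom F G" using hk by (auto simp: frith_hom_def)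
  show "h = k"
  proof (rule PiE_ext[OF frame_hom_funcset[OF hf(1)] frame_hom_funcset[OF hf(2)]])
    fix a assume a: "a \<in> carrier F"
    then have "nabla G (h a) = nabla G (k a)" using hk Sk_map_nabla by metis
    then show "h a = k a"
      using G.nabla_inj a frame_hom_closed[OF hf(1) a] frame_hom_closed[OF hf(2) a]
      by (auto dest: inj_onD)
  qed
qed

text \<open>
  The transpose of \<open>g\<close> takes values in the image of \<open>\<nabla>\<close>, which is injective, so it factors
  through \<open>\<nabla>\<close> as some \<open>h\<close>.  That \<open>h\<close> preserves the generators is the strong exactness of
  \<^term>\<open>G\<close>.
\<close>

lemma Sk_map_surj:
  assumes G: "strongly_exact_frith_frame G" and g: "g \<in> biframe_hom (Sk F) (Sk G)"
  obtains h where "h \<in> frith_hom F G" "extends_along_nabla F G h g"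
proof -
  interpret SG: strongly_exact_frith_frame G by fact
  define t where "t = Sk_transpose F g"
  have t: "t \<in> frith_hom F (coreflector (Sk G))"
    unfolding t_def by (rule Sk_transpose_frith_hom[OF g])
  have "t \<in> frame_hom F (coreflector (Sk G))" using t by (simp add: frith_hom_def)
  then have tf: "t \<in> frame_hom F (Sk G)" and tpos: "t ` carrier F \<subseteq> nabla G ` carrier G"
    using A.P.frame_hom_into_M[OF F.frame_axioms, of t] by (auto simp: coreflector_simps G.Sk_simps)
  define h where "h = (\<lambda>a\<in>carrier F. inv_into (carrier G) (nabla G) (t a))"
  have hc: "h a \<in> carrier G" and hn: "nabla G (h a) = t a" if a: "a \<in> carrier F" for a
  proof -
    have "t a \<in> nabla G ` carrier G" using a tpos by blast
    then show "h a \<in> carrier G" "nabla G (h a) = t a"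
      using a by (simp_all add: h_def inv_into_into f_inv_into_f)
  qed
  have nabla_eq: "x = y" if "x \<in> carrier G" "y \<in> carrier G" "nabla G x = nabla G y" for x y
    using G.nabla_inj that by (auto dest: inj_onD)
  have n: "(\<lambda>a\<in>carrier G. nabla G a) \<in> frame_hom G (Sk G)" by (rule G.nabla_frame_hom)
  have "h \<in> frame_hom F G"
  proof (rule frame_homI)
    show "h \<in> carrier F \<rightarrow>\<^sub>E carrier G" using hc by (auto simp: h_def)
    show "h \<top>\<^bsub>F\<^esub> = \<top>\<^bsub>G\<^esub>"
      using hc hn frame_hom_top[OF tf] frame_hom_top[OF n] by (intro nabla_eq) simp_all
    show "h (x \<sqinter>\<^bsub>F\<^esub> y) = h x \<sqinter>\<^bsub>G\<^esub> h y" if xy: "x \<in> carrier F" "y \<in> carrier F" for x y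
      using xy hc hn frame_hom_meet[OF tf xy] frame_hom_meet[OF n hc[OF xy(1)] hc[OF xy(2)]]
      by (intro nabla_eq) simp_all
    show "h (\<Squnion>\<^bsub>F\<^esub>X) = \<Squnion>\<^bsub>G\<^esub>(h ` X)" if X: "X \<subseteq> carrier F" for X
    proof (rule nabla_eq)
      have hX: "h ` X \<subseteq> carrier G" using X hc by blast
      then show "\<Squnion>\<^bsub>G\<^esub>(h ` X) \<in> carrier G" by simp
      show "h (\<Squnion>\<^bsub>F\<^esub>X) \<in> carrier G" using X hc by simp
      have "(\<lambda>a\<in>carrier G. nabla G a) ` (h ` X) = t ` X"
        unfolding image_image using X hc hn by (intro image_cong) auto
      then have "nabla G (\<Squnion>\<^bsub>G\<^esub>(h ` X)) = \<Squnion>\<^bsub>Sk G\<^esub>(t ` X)"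
        using frame_hom_Sup[OF n hX] hX by simp
      also have "\<dots> = nabla G (h (\<Squnion>\<^bsub>F\<^esub>X))"
        using X hn frame_hom_Sup[OF tf X] by simp
      finally show "nabla G (h (\<Squnion>\<^bsub>F\<^esub>X)) = nabla G (\<Squnion>\<^bsub>G\<^esub>(h ` X))" by simp
    qed
  qed
  moreover have "h s \<in> gens G" if s: "s \<in> gens F" for s
  proof (rule SG.bicomplemented_nabla_gens)
    have sc: "s \<in> carrier F" using s by (rule F.gens_carrier)
    then show "h s \<in> carrier G" by (rule hc)
    have "t s \<in> gens (coreflector (Sk G))" using t s by (auto simp: frith_hom_def)
    then show "nabla G (h s) \<in> bicomplemented_pos (Sk G)"
      using hn[OF sc] by (simp add: coreflector_simps)
  qed
  ultimately have "h \<in> frith_hom F G" by (auto simp: frith_hom_def)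
  moreover have "extends_along_nabla F G h g"
    using g hn by (simp add: extends_along_nabla_def biframe_hom_def t_def Sk_transpose_apply)
  ultimately show ?thesis by (rule that)
qed

theorem Sk_map_bij:
  assumes "strongly_exact_frith_frame G"
  shows "bij_betw (Sk_map F G) (frith_hom F G) (biframe_hom (Sk F) (Sk G))"
  unfolding bij_betw_def
proof (intro conjI Sk_map_inj subset_antisym subsetI)
  show "g \<in> biframe_hom (Sk F) (Sk G)" if "g \<in> Sk_map F G ` frith_hom F G" for g
    using that Sk_map_hom(2) by blast
  show "g \<in> Sk_map F G ` frith_hom F G" if g: "g \<in> biframe_hom (Sk F) (Sk G)" for g
    using Sk_map_surj[OF assms g] Sk_map_eqI by blast
qed

end

lemma Sk_functorI:
  "strongly_exact_frith_frame F \<Longrightarrow> strongly_exact_frith_frame G \<Longrightarrow> Sk_functor F G"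
  by (simp add: Sk_functor_def strongly_exact_frith_frame_def)

lemma Sk_map_id:
  assumes "frith_frame F"
  shows "Sk_map F F (\<lambda>a\<in>carrier F. a) = (\<lambda>\<theta>\<in>carrier (Sk F). \<theta>)"
proof -
  interpret F: frith_frame F by fact
  interpret Sk_functor F F ..
  show ?thesis
    by (rule Sk_map_eqI)
      (simp add: extends_along_nabla_def frame_hom_id[OF F.Sk.frame_M] F.nabla_Sk)
qed

lemma Sk_map_compose:
  assumes "frith_frame F" "frith_frame G" "frith_frame H"
    and h: "h \<in> frith_hom F G" and k: "k \<in> frith_hom G H"
  shows "Sk_map F H (compose (carrier F) k h) =
    compose (carrier (Sk F)) (Sk_map G H k) (Sk_map F G h)"
proof -
  interpret F: frith_frame F by fact
  interpret G: frith_frame G by fact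
  interpret H: frith_frame H by fact
  interpret FG: Sk_functor F G ..
  interpret GH: Sk_functor G H ..
  interpret FH: Sk_functor F H ..
  have hc: "h a \<in> carrier G" if "a \<in> carrier F" for a
    using that h frame_hom_closed[of h F G] by (simp add: frith_hom_def)
  have "compose (carrier (Sk F)) (Sk_map G H k) (Sk_map F G h) \<in> frame_hom (Sk F) (Sk H)"
    using FG.Sk_map_hom(2)[OF h] GH.Sk_map_hom(2)[OF k]
    by (intro frame_hom_compose[OF F.Sk.frame_M]) (auto simp: biframe_hom_def)
  then have "extends_along_nabla F H (compose (carrier F) k h)
      (compose (carrier (Sk F)) (Sk_map G H k) (Sk_map F G h))"
    using hc by (simp add: extends_along_nabla_def compose_def F.nabla_Sk
        FG.Sk_map_nabla[OF h] GH.Sk_map_nabla[OF k])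
  then show ?thesis by (rule FH.Sk_map_eqI)
qed

lemma coreflector_map_compose:
  assumes "zero_dimensional_biframe A" "f \<in> biframe_hom A B"
  shows "coreflector_map A (compose (carrier A) g f) =
    compose (carrier (coreflector A)) (coreflector_map B g) (coreflector_map A f)"
proof -
  interpret A: zero_dimensional_biframe A by fact
  have "f x \<in> pos B" "x \<in> carrier A" if "x \<in> pos A" for x
    using assms(2) that A.pos_carrier by (auto simp: biframe_hom_def)
  then show ?thesis
    by (auto simp: coreflector_map_def compose_def coreflector_simps restrict_def)
qed

lemma Sk_transpose_natural:
  assumes "frith_frame F" "frith_frame G"
    and h: "h \<in> frith_hom F G" and g: "g \<in> biframe_hom (Sk G) A"
  shows "Sk_transpose F (compose (carrier (Sk F)) f (compose (carrier (Sk F)) g (Sk_map F G h))) =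
    compose (carrier F) (coreflector_map A f) (compose (carrier F) (Sk_transpose G g) h)"
proof -
  interpret F: frith_frame F by fact
  interpret G: frith_frame G by fact
  interpret FG: Sk_functor F G ..
  have hc: "h a \<in> carrier G" if "a \<in> carrier F" for a
    using that h frame_hom_closed[of h F G] by (simp add: frith_hom_def)
  have gp: "g (nabla G b) \<in> pos A" if "b \<in> carrier G" for b
    using that g by (auto simp: biframe_hom_def G.Sk_simps)
  show ?thesis
    by (auto simp: Sk_transpose_def compose_def coreflector_map_def restrict_def
        F.nabla_Sk FG.Sk_map_nabla[OF h] hc gp)
qed

theorem corollary3p9:
  fixes F :: "'a frith" and G :: "'b frith" and H :: "'c frith"
    and A :: "'d biframe_rec" and B :: "'e biframe_rec" and C :: "'f biframe_rec"
  shows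
    \<comment> \<open>\<^const>\<open>Sk\<close> restricts to a functor between the two full subcategories\<close>
    "(strongly_exact_frith_frame F \<longrightarrow> zero_dimensional_biframe (Sk F)) \<and>
     (strongly_exact_frith_frame F \<and> strongly_exact_frith_frame G \<longrightarrow>
        (\<forall>h\<in>frith_hom F G.
           (\<exists>!g. extends_along_nabla F G h g) \<and> Sk_map F G h \<in> biframe_hom (Sk F) (Sk G))) \<and>
     (strongly_exact_frith_frame F \<longrightarrow>
        Sk_map F F (\<lambda>a\<in>carrier F. a) = (\<lambda>\<theta>\<in>carrier (Sk F). \<theta>)) \<and>
     (strongly_exact_frith_frame F \<and> strongly_exact_frith_frame G \<and>
      strongly_exact_frith_frame H \<longrightarrow>
        (\<forall>h\<in>frith_hom F G. \<forall>k\<in>frith_hom G H.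
           Sk_map F H (compose (carrier F) k h) =
           compose (carrier (Sk F)) (Sk_map G H k) (Sk_map F G h))) \<and>
     \<comment> \<open>full and faithful\<close>
     (strongly_exact_frith_frame F \<and> strongly_exact_frith_frame G \<longrightarrow>
        bij_betw (Sk_map F G) (frith_hom F G) (biframe_hom (Sk F) (Sk G))) \<and>
     \<comment> \<open>\<^const>\<open>coreflector\<close> is a functor in the other direction\<close>
     (zero_dimensional_biframe A \<longrightarrow> strongly_exact_frith_frame (coreflector A)) \<and>
     (zero_dimensional_biframe A \<and> zero_dimensional_biframe B \<longrightarrow>
        (\<forall>f\<in>biframe_hom A B.
           coreflector_map A f \<in> frith_hom (coreflector A) (coreflector B))) \<and>
     (zero_dimensional_biframe A \<longrightarrow>
        coreflector_map A (\<lambda>x\<in>carrier A. x) = (\<lambda>x\<in>carrier (coreflector A). x)) \<and>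
     (zero_dimensional_biframe A \<and> zero_dimensional_biframe B \<and> zero_dimensional_biframe C \<longrightarrow>
        (\<forall>f\<in>biframe_hom A B. \<forall>g\<in>biframe_hom B C.
           coreflector_map A (compose (carrier A) g f) =
           compose (carrier (coreflector A)) (coreflector_map B g) (coreflector_map A f))) \<and>
     \<comment> \<open>and it is right adjoint to \<^const>\<open>Sk\<close>: a bijection of hom-sets, natural in both arguments\<close>
     (strongly_exact_frith_frame F \<and> zero_dimensional_biframe A \<longrightarrow>
        bij_betw (Sk_transpose F) (biframe_hom (Sk F) A) (frith_hom F (coreflector A))) \<and>
     (strongly_exact_frith_frame F \<and> strongly_exact_frith_frame G \<and>
      zero_dimensional_biframe A \<and> zero_dimensional_biframe B \<longrightarrow>
        (\<forall>h\<in>frith_hom F G. \<forall>g\<in>biframe_hom (Sk G) A. \<forall>f\<in>biframe_hom A B.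
           Sk_transpose F (compose (carrier (Sk F)) f (compose (carrier (Sk F)) g (Sk_map F G h))) =
           compose (carrier F) (coreflector_map A f) (compose (carrier F) (Sk_transpose G g) h)))"
proof (intro conjI impI ballI)
  assume "strongly_exact_frith_frame F"
  then interpret F: strongly_exact_frith_frame F .
  show "zero_dimensional_biframe (Sk F)" by (rule F.zero_dimensional_Sk)
  show "Sk_map F F (\<lambda>a\<in>carrier F. a) = (\<lambda>\<theta>\<in>carrier (Sk F). \<theta>)"
    by (rule Sk_map_id[OF F.frith_frame_axioms])
next
  fix h
  assume FG: "strongly_exact_frith_frame F \<and> strongly_exact_frith_frame G"
    and h: "h \<in> frith_hom F G"
  interpret Sk_functor F G using FG by (simp add: Sk_functorI)
  show "\<exists>!g. extends_along_nabla F G h g"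
    using Sk_map_hom(1)[OF h] extends_along_nabla_unique by blast
  show "Sk_map F G h \<in> biframe_hom (Sk F) (Sk G)"
    by (rule Sk_map_hom(2)[OF h])
next
  fix h k
  assume "strongly_exact_frith_frame F \<and> strongly_exact_frith_frame G \<and>
    strongly_exact_frith_frame H" "h \<in> frith_hom F G" "k \<in> frith_hom G H"
  then show "Sk_map F H (compose (carrier F) k h) =
      compose (carrier (Sk F)) (Sk_map G H k) (Sk_map F G h)"
    by (intro Sk_map_compose) (auto simp: strongly_exact_frith_frame_def)
next
  assume FG: "strongly_exact_frith_frame F \<and> strongly_exact_frith_frame G"
  interpret Sk_functor F G using FG by (simp add: Sk_functorI)
  show "bij_betw (Sk_map F G) (frith_hom F G) (biframe_hom (Sk F) (Sk G))"
    using FG by (intro Sk_map_bij) simp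
next
  assume "zero_dimensional_biframe A"
  then interpret A: zero_dimensional_biframe A .
  show "strongly_exact_frith_frame (coreflector A)" by (rule A.strongly_exact_coreflector)
  show "coreflector_map A (\<lambda>x\<in>carrier A. x) = (\<lambda>x\<in>carrier (coreflector A). x)"
    using A.pos_carrier by (auto simp: coreflector_map_def coreflector_simps restrict_def)
next
  fix f
  assume "zero_dimensional_biframe A \<and> zero_dimensional_biframe B" "f \<in> biframe_hom A B"
  then show "coreflector_map A f \<in> frith_hom (coreflector A) (coreflector B)"
    by (intro coreflector_map_frith_hom) auto
next
  fix f g
  assume "zero_dimensional_biframe A \<and> zero_dimensional_biframe B \<and> zero_dimensional_biframe C"
    "f \<in> biframe_hom A B" "g \<in> biframe_hom B C"
  then show "coreflector_map A (compose (carrier A) g f) =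
      compose (carrier (coreflector A)) (coreflector_map B g) (coreflector_map A f)"
    by (intro coreflector_map_compose) auto
next
  assume "strongly_exact_frith_frame F \<and> zero_dimensional_biframe A"
  then have "coreflection F A" by (simp add: coreflection_def strongly_exact_frith_frame_def)
  then show "bij_betw (Sk_transpose F) (biframe_hom (Sk F) A) (frith_hom F (coreflector A))"
    by (rule coreflection.Sk_transpose_bij)
next
  fix h g f
  assume "strongly_exact_frith_frame F \<and> strongly_exact_frith_frame G \<and>
      zero_dimensional_biframe A \<and> zero_dimensional_biframe B"
    "h \<in> frith_hom F G" "g \<in> biframe_hom (Sk G) A" "f \<in> biframe_hom A B"
  then show "Sk_transpose F (compose (carrier (Sk F)) f (compose (carrier (Sk F)) g (Sk_map F G h))) =
      compose (carrier F) (coreflector_map A f) (compose (carrier F) (Sk_transpose G g) h)"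
    by (intro Sk_transpose_natural) (auto simp: strongly_exact_frith_frame_def)
qed

end
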